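(* Let $(\dot A,\widehat A,A)$ and $(\dot B,\widehat B,B)$ be triples in Hilbert spaces $\mathcal H_A$ and $\mathcal H_B$, where $\dot A,\dot B$ are prime, closed, densely defined symmetric operators with deficiency indices $(1,1)$, $A,B$ are self-adjoint extensions of $\dot A,\dot B$, and $\widehat A\ne(\widehat A)^*$, $\widehat B\ne(\widehat B)^*$ are maximal dissipative extensions of $\dot A,\dot B$, respectively. Let $\kappa_A,\kappa_B$ be the von Neumann parameters of the two triples, and let $\mathcal M_A=\mathcal M(\widehat A)$, $\mathcal M_B=\mathcal M(\widehat B)$ be the Weyl–Titchmarsh functions of the dissipative operators. Assume $\kappa_A\ne0$ and $\kappa_B\neq 0$. Then the characteristic function of each triple is uniquely determined by the corresponding pair $(\kappa,\mathcal M)$, and the pair $(\kappa,\mathcal M)$ is a complete unitary invariant: the triples $(\dot A,\widehat A,A)$ and $(\dot B,\widehat B,B)$ are unitarily equivalent if and only if $\kappa_A=\kappa_B$ and $\mathcal M_A=\mathcal M_B$ on $\mathbb C_+$.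
   Context: $\mathbb C_+$ is the open upper half-plane; inner products are linear in the first argument. A symmetric operator $\dot A$ is prime if there is no nonzero closed subspace invariant under $\dot A$ such that the restriction of $\dot A$ to it is self-adjoint. A maximal dissipative extension $\widehat A$ of $\dot A$ is a maximal operator extending $\dot A$ with $\operatorname{Im}(\widehat Af,f)\ge0$ on $\operatorname{Dom}(\widehat A)$; it satisfies $\dot A\subset\widehat A\subset(\dot A)^*$. Unitary equivalence of triples: there is a unitary map $\mathcal U$ from $\mathcal H_A$ onto $\mathcal H_B$ with $\dot B=\mathcal U\dot A\mathcal U^{-1}$, $\widehat B=\mathcal U\widehat A\mathcal U^{-1}$, $B=\mathcal UA\mathcal U^{-1}$. For a triple $(\dot A,\widehat A,A)$ choose $g_\pm\in\operatorname{Ker}((\dot A)^*\mp iI)$, $\|g_\pm\|=1$, with $g_+-g_-\in\operatorname{Dom}(A)$. The von Neumann parameter of the triple is the number $\kappa$, $|\kappa|<1$, such that $g_+-\kappa g_-\in\operatorname{Dom}(\widehat A)$. The Weyl–Titchmarsh function of $\widehat A$ is $$\mathcal M(z)=\left(((\widehat A)^*z+I)((\widehat A)^*-zI)^{-1}g_+,g_+\right),\quad z\in\mathbb C_+ .$$ The Livšic function of $(\dot A,A)$ is $s(z)=\frac{z-i}{z+i}\cdot\frac{(g_z,g_-)}{(g_z,g_+)}$, $z\in\mathbb C_+$, with $0\ne g_z\in\operatorname{Ker}((\dot A)^*-zI)$ arbitrary, and the characteristic function of the triple is $S(z)=\frac{s(z)-\kappa}{\overline\kappa s(z)-1}$, $z\in\mathbb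 C_+$. *)

theory Defs
  imports "HOL-Analysis.Analysis"
begin

section \<open>Complex Hilbert spaces\<close>

class complex_vector = real_vector +
  fixes scaleC :: "complex \<Rightarrow> 'a \<Rightarrow> 'a"  (infixr \<open>*\<^sub>C\<close> 75)
  assumes scaleC_add_right: "a *\<^sub>C (x + y) = a *\<^sub>C x + a *\<^sub>C y"
    and scaleC_add_left: "(a + b) *\<^sub>C x = a *\<^sub>C x + b *\<^sub>C x"
    and scaleC_scaleC: "a *\<^sub>C b *\<^sub>C x = (a * b) *\<^sub>C x"
    and scaleC_one: "1 *\<^sub>C x = x"
    and scaleR_scaleC: "r *\<^sub>R x = complex_of_real r *\<^sub>C x"

text \<open>Linear in the first argument; the last axiom contains positive definiteness.\<close>

class complex_inner = complex_vector + real_normed_vector +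
  fixes cinner :: "'a \<Rightarrow> 'a \<Rightarrow> complex"
  assumes cinner_commute: "cinner x y = cnj (cinner y x)"
    and cinner_add_left: "cinner (x + y) w = cinner x w + cinner y w"
    and cinner_scaleC_left: "cinner (a *\<^sub>C x) y = a * cinner x y"
    and cinner_self: "cinner x x = complex_of_real ((norm x)\<^sup>2)"

class chilbert_space = complex_inner + complete_space

global_interpretation complex_vector:
  vector_space "scaleC :: complex \<Rightarrow> 'a \<Rightarrow> 'a :: complex_vector"
  by unfold_locales (simp_all add: scaleC_add_right scaleC_add_left scaleC_scaleC scaleC_one)

instantiation complex :: chilbert_space
begin

definition scaleC_complex :: "complex \<Rightarrow> complex \<Rightarrow> complex"
  where "scaleC_complex a x = a * x"

definition cinner_complex :: "complex \<Rightarrow> complex \<Rightarrow> complex"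
  where "cinner_complex x y = x * cnj y"

instance proof
  fix a b x y w :: complex and r :: real
  show "a *\<^sub>C (x + y) = a *\<^sub>C x + a *\<^sub>C y" "(a + b) *\<^sub>C x = a *\<^sub>C x + b *\<^sub>C x"
    by (simp_all add: scaleC_complex_def distrib_left distrib_right)
  show "a *\<^sub>C b *\<^sub>C x = (a * b) *\<^sub>C x" "1 *\<^sub>C x = x"
    by (simp_all add: scaleC_complex_def mult.assoc)
  show "r *\<^sub>R x = complex_of_real r *\<^sub>C x"
    by (simp add: scaleC_complex_def scaleR_conv_of_real)
  show "cinner x y = cnj (cinner y x)"
    by (simp add: cinner_complex_def mult.commute)
  show "cinner (x + y) w = cinner x w + cinner y w"
    by (simp add: cinner_complex_def distrib_right)
  show "cinner (a *\<^sub>C x) y = a * cinner x y"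
    by (simp add: scaleC_complex_def cinner_complex_def mult.assoc)
  show "cinner x x = complex_of_real ((norm x)\<^sup>2)"
    unfolding cinner_complex_def by (rule complex_norm_square [symmetric])
qed

end

instantiation prod :: (complex_vector, complex_vector) complex_vector
begin

definition scaleC_prod :: "complex \<Rightarrow> 'a \<times> 'b \<Rightarrow> 'a \<times> 'b"
  where "scaleC_prod a p = (a *\<^sub>C fst p, a *\<^sub>C snd p)"

instance proof
  fix a b :: complex and x y :: "'a \<times> 'b" and r :: real
  show "a *\<^sub>C (x + y) = a *\<^sub>C x + a *\<^sub>C y" "(a + b) *\<^sub>C x = a *\<^sub>C x + b *\<^sub>C x"
    by (simp_all add: scaleC_prod_def scaleC_add_right scaleC_add_left)
  show "a *\<^sub>C b *\<^sub>C x = (a * b) *\<^sub>C x" "1 *\<^sub>C x = x"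
    by (simp_all add: scaleC_prod_def scaleC_scaleC scaleC_one)
  show "r *\<^sub>R x = complex_of_real r *\<^sub>C x"
    by (simp add: scaleC_prod_def prod_eq_iff scaleR_scaleC)
qed

end

definition unitary :: "('a::complex_inner \<Rightarrow> 'b::complex_inner) \<Rightarrow> bool"
  where "unitary U \<longleftrightarrow> Vector_Spaces.linear scaleC scaleC U \<and> bij U \<and>
    (\<forall>x y. cinner (U x) (U y) = cinner x y)"


section \<open>Unbounded operators\<close>

text \<open>An operator is identified with its graph, so that extension of operators is inclusion,
  the domain is \<^const>\<open>Domain\<close>, the inverse is the converse relation, and a closed operator is a
  closed subset of the product space.\<close>

type_synonym 'a operator = "('a \<times> 'a) set"

definition linear_operator :: "'a::complex_vector operator \<Rightarrow> bool"
  where "linear_operator T \<longleftrightarrow> complex_vector.subspace T \<and> single_valued T"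

definition apply_op :: "'a operator \<Rightarrow> 'a \<Rightarrow> 'a"
  where "apply_op T x = (THE y. (x, y) \<in> T)"

text \<open>The operator \<open>a T + b I\<close> on the domain of \<open>T\<close>.\<close>

definition affine_op :: "complex \<Rightarrow> 'a::complex_vector operator \<Rightarrow> complex \<Rightarrow> 'a operator"
  where "affine_op a T b = {(f, a *\<^sub>C h + b *\<^sub>C f) |f h. (f, h) \<in> T}"

definition kernel_op :: "'a::zero operator \<Rightarrow> 'a set"
  where "kernel_op T = {f. (f, 0) \<in> T}"

text \<open>Density of the domain, the adjoint and self-adjointness are taken relative to a closed
  subspace \<open>M\<close>, regarded as a Hilbert space in its own right.\<close>

definition densely_defined_in :: "'a::complex_inner set \<Rightarrow> 'a operator \<Rightarrow> bool"
  where "densely_defined_in M T \<longleftrightarrow> M \<subseteq> closure (Domain T)"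

definition adjoint_in :: "'a::complex_inner set \<Rightarrow> 'a operator \<Rightarrow> 'a operator"
  where "adjoint_in M T =
    {(g, h). g \<in> M \<and> h \<in> M \<and> (\<forall>(f, f') \<in> T. cinner f' g = cinner f h)}"

definition selfadjoint_in :: "'a::complex_inner set \<Rightarrow> 'a operator \<Rightarrow> bool"
  where "selfadjoint_in M T \<longleftrightarrow> linear_operator T \<and> T \<subseteq> M \<times> M \<and>
    densely_defined_in M T \<and> adjoint_in M T = T"

abbreviation densely_defined :: "'a::complex_inner operator \<Rightarrow> bool"
  where "densely_defined \<equiv> densely_defined_in UNIV"

abbreviation adjoint_op :: "'a::complex_inner operator \<Rightarrow> 'a operator"
  where "adjoint_op \<equiv> adjoint_in UNIV"

abbreviation selfadjoint :: "'a::complex_inner operator \<Rightarrow> bool"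
  where "selfadjoint \<equiv> selfadjoint_in UNIV"

definition symmetric_op :: "'a::complex_inner operator \<Rightarrow> bool"
  where "symmetric_op T \<longleftrightarrow> linear_operator T \<and>
    (\<forall>(f, f') \<in> T. \<forall>(g, g') \<in> T. cinner f' g = cinner f g')"

definition restrict_op :: "'a operator \<Rightarrow> 'a set \<Rightarrow> 'a operator"
  where "restrict_op T M = {(f, h) \<in> T. f \<in> M}"

definition prime_op :: "'a::complex_inner operator \<Rightarrow> bool"
  where "prime_op T \<longleftrightarrow> \<not> (\<exists>M. complex_vector.subspace M \<and> closed M \<and> M \<noteq> {0} \<and>
    (\<forall>(f, h) \<in> T. f \<in> M \<longrightarrow> h \<in> M) \<and> selfadjoint_in M (restrict_op T M))"

definition deficiency_space :: "'a::complex_inner operator \<Rightarrow> complex \<Rightarrow> 'a set"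
  where "deficiency_space T z = kernel_op (affine_op 1 (adjoint_op T) (- z))"

definition dissipative :: "'a::complex_inner operator \<Rightarrow> bool"
  where "dissipative T \<longleftrightarrow> linear_operator T \<and> (\<forall>(f, h) \<in> T. 0 \<le> Im (cinner h f))"

definition maximal_dissipative_extension ::
    "'a::complex_inner operator \<Rightarrow> 'a operator \<Rightarrow> bool"
  where "maximal_dissipative_extension T0 T \<longleftrightarrow> T0 \<subseteq> T \<and> dissipative T \<and>
    (\<forall>T'. dissipative T' \<and> T \<subseteq> T' \<longrightarrow> T' = T)"


section \<open>Triples and their invariants\<close>

text \<open>In a triple \<open>(T0, Th, T)\<close>, \<open>T0\<close> is the symmetric operator, \<open>Th\<close> the dissipative
  extension and \<open>T\<close> the self-adjoint (reference) extension.\<close>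

definition operator_triple ::
    "'a::chilbert_space operator \<Rightarrow> 'a operator \<Rightarrow> 'a operator \<Rightarrow> bool"
  where "operator_triple T0 Th T \<longleftrightarrow>
    symmetric_op T0 \<and> densely_defined T0 \<and> closed T0 \<and> prime_op T0 \<and>
    complex_vector.dim (deficiency_space T0 \<i>) = 1 \<and>
    complex_vector.dim (deficiency_space T0 (- \<i>)) = 1 \<and>
    T0 \<subseteq> T \<and> selfadjoint T \<and>
    maximal_dissipative_extension T0 Th \<and> Th \<noteq> adjoint_op Th"

definition unitarily_equivalent_triples ::
    "'a::chilbert_space operator \<Rightarrow> 'a operator \<Rightarrow> 'a operator \<Rightarrow>
     'b::chilbert_space operator \<Rightarrow> 'b operator \<Rightarrow> 'b operator \<Rightarrow> bool"
  where "unitarily_equivalent_triples A0 Ah A B0 Bh B \<longleftrightarrow>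
    (\<exists>U. unitary U \<and> B0 = map_prod U U ` A0 \<and> Bh = map_prod U U ` Ah \<and> B = map_prod U U ` A)"

text \<open>The admissible choices of \<open>g\<^sub>+\<close> and \<open>g\<^sub>-\<close>; they are unique up to a common unimodular
  factor, which cancels in the three quantities below.\<close>

definition deficiency_vectors ::
    "'a::chilbert_space operator \<Rightarrow> 'a operator \<Rightarrow> 'a \<Rightarrow> 'a \<Rightarrow> bool"
  where "deficiency_vectors T0 T gp gm \<longleftrightarrow>
    gp \<in> deficiency_space T0 \<i> \<and> norm gp = 1 \<and>
    gm \<in> deficiency_space T0 (- \<i>) \<and> norm gm = 1 \<and>
    gp - gm \<in> Domain T"

definition von_Neumann_parameter :: "'a::chilbert_space operator \<Rightarrow> 'a \<Rightarrow> 'a \<Rightarrow> complex"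
  where "von_Neumann_parameter Th gp gm =
    (THE \<kappa>. cmod \<kappa> < 1 \<and> gp - \<kappa> *\<^sub>C gm \<in> Domain Th)"

text \<open>Relational composition \<open>O\<close> applies its left factor first.\<close>

definition Weyl_Titchmarsh :: "'a::chilbert_space operator \<Rightarrow> 'a \<Rightarrow> complex \<Rightarrow> complex"
  where "Weyl_Titchmarsh Th gp z =
    cinner (apply_op ((affine_op 1 (adjoint_op Th) (- z))\<inverse> O affine_op z (adjoint_op Th) 1) gp) gp"

definition Livsic ::
    "'a::chilbert_space operator \<Rightarrow> 'a \<Rightarrow> 'a \<Rightarrow> complex \<Rightarrow> complex"
  where "Livsic T0 gp gm z =
    (let g = (SOME g. g \<in> deficiency_space T0 z \<and> g \<noteq> 0)
     in (z - \<i>) / (z + \<i>) * (cinner g gm / cinner g gp))"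

definition characteristic_function ::
    "'a::chilbert_space operator \<Rightarrow> 'a operator \<Rightarrow> 'a \<Rightarrow> 'a \<Rightarrow> complex \<Rightarrow> complex"
  where "characteristic_function T0 Th gp gm z =
    (let s = Livsic T0 gp gm z; \<kappa> = von_Neumann_parameter Th gp gm
     in (s - \<kappa>) / (cnj \<kappa> * s - 1))"

end

theory Submission
  imports Defs
begin

text \<open>The proof is a computation with boundary coefficients. Modulo the domain of the symmetric
  operator \<open>A0\<close>, every vector in the domain of its adjoint is \<open>a g\<^sub>+ + b g\<^sub>-\<close>, and Green's identity
  expresses the defect of symmetry of the adjoint by the form \<open>2 i (a cnj c - b cnj d)\<close> in these
  coefficients. The three operators of a triple become boundary conditions: \<open>A\<close> is \<open>a + b = 0\<close>,
  the dissipative extension \<open>Ah\<close> is \<open>b = - \<kappa> a\<close> with \<open>\<bar>\<kappa>\<bar> < 1\<close>, and the adjoint of \<open>Ah\<close> is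
  \<open>a = - cnj \<kappa> b\<close>.

  For an eigenvector of the adjoint at a point \<open>z\<close> of the upper half-plane, \<open>b = - s(z) a\<close> with
  the Livsic function \<open>s\<close>, and \<open>\<bar>s\<bar> < 1\<close>. Solving for the resolvent of the adjoint of \<open>Ah\<close> in these
  coordinates gives (\<open>Weyl_Titchmarsh_Livsic\<close>)
  \<open>M(z) = i (1 + cnj \<kappa> s(z)) / (1 - cnj \<kappa> s(z))\<close>.
  So, for a given \<open>\<kappa> \<noteq> 0\<close>, the functions \<open>M\<close> and \<open>s\<close> determine each other, and the characteristic
  function is a function of \<open>\<kappa>\<close> and \<open>s\<close>. For \<open>\<kappa> = 0\<close> the formula degenerates to \<open>M = i\<close>.

  It remains to see that \<open>(\<kappa>, s)\<close> is a complete unitary invariant. The invariance follows from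
  the uniqueness of \<open>(g\<^sub>+, g\<^sub>-)\<close> up to a common phase (\<open>invariants_of_unitary_equivalence\<close>). For
  the converse, the vectors \<open>(A - i) (A - z)\<^sup>-\<^sup>1 g\<^sub>+\<close>, for all nonreal \<open>z\<close>, are eigenvectors of the adjoint
  of \<open>A0\<close> whose boundary coefficients add up to one. By Green's identity and continuity
  in \<open>z\<close>, their inner products are functions of \<open>s\<close> (\<open>gvec_cinner\<close>, \<open>gvec_tendsto\<close>), and by primality
  they span a dense subspace (\<open>gvec_span_dense\<close>). Two triples with the same \<open>s\<close> are therefore related by
  a unitary map matching these vectors; it carries \<open>g\<^sub>+\<close>, \<open>g\<^sub>-\<close> and the resolvent of \<open>A\<close> along, hence \<open>A\<close>,
  and with it \<open>A0\<close> and, if \<open>\<kappa>\<close> agrees, \<open>Ah\<close> (\<open>unitary_equivalence_of_invariants\<close>).\<close>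

section \<open>Geometry of complex Hilbert spaces\<close>

lemma cinner_add_right: "cinner (x::'a::complex_inner) (y + w) = cinner x y + cinner x w"
  by (metis cinner_add_left cinner_commute complex_cnj_add)

lemma cinner_scaleC_right: "cinner (x::'a::complex_inner) (a *\<^sub>C y) = cnj a * cinner x y"
  by (metis cinner_scaleC_left cinner_commute complex_cnj_mult)

lemma scaleC_minus_one: "(- 1) *\<^sub>C (x::'a::complex_vector) = - x"
  using complex_vector.scale_minus_left[of 1 x] by (simp add: scaleC_one)

lemma cinner_minus_left: "cinner (- x) (y::'a::complex_inner) = - cinner x y"
  by (metis cinner_scaleC_left mult_minus1 scaleC_minus_one)

lemma cinner_minus_right: "cinner x (- y::'a::complex_inner) = - cinner x y"
  by (metis cinner_commute cinner_minus_left complex_cnj_minus)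

lemma cinner_diff_left: "cinner (x - y) (w::'a::complex_inner) = cinner x w - cinner y w"
  by (metis cinner_add_left cinner_minus_left diff_conv_add_uminus)

lemma cinner_diff_right: "cinner (w::'a::complex_inner) (x - y) = cinner w x - cinner w y"
  by (metis cinner_add_right cinner_minus_right diff_conv_add_uminus)

lemma cinner_zero_left [simp]: "cinner 0 (y::'a::complex_inner) = 0"
  using cinner_diff_left[of 0 0 y] by simp

lemma cinner_zero_right [simp]: "cinner (y::'a::complex_inner) 0 = 0"
  using cinner_diff_right[of y 0 0] by simp

lemmas cinner_expand = cinner_add_left cinner_add_right cinner_diff_left cinner_diff_right
  cinner_minus_left cinner_minus_right cinner_scaleC_left cinner_scaleC_right

lemma cinner_self_eq_0 [simp]: "cinner (x::'a::complex_inner) x = 0 \<longleftrightarrow> x = 0"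
  by (simp add: cinner_self)

lemma cinner_eqI:
  assumes "\<And>w. cinner w x = cinner w (y::'a::complex_inner)" shows "x = y"
proof -
  have "cinner (x - y) (x - y) = 0" using assms by (simp add: cinner_diff_right)
  then show ?thesis by simp
qed

lemma of_real_cmod_square: "(complex_of_real (cmod c))\<^sup>2 = c * cnj c"
  by (metis complex_norm_square of_real_power)

lemma norm_scaleC: "norm (a *\<^sub>C (x::'a::complex_inner)) = cmod a * norm x"
proof -
  have "complex_of_real ((norm (a *\<^sub>C x))\<^sup>2) = complex_of_real ((cmod a * norm x)\<^sup>2)"
    unfolding cinner_self[symmetric] cinner_scaleC_left cinner_scaleC_right
    by (simp add: cinner_self power_mult_distrib of_real_cmod_square mult.commute)
  then have "(norm (a *\<^sub>C x))\<^sup>2 = (cmod a * norm x)\<^sup>2" using of_real_eq_iff by blast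
  then show ?thesis by (simp add: power2_eq_iff_nonneg)
qed

lemma norm_square_cinner: "(norm (x::'a::complex_inner))\<^sup>2 = Re (cinner x x)"
  by (simp add: cinner_self)

text \<open>The inequality is the nonnegativity of the square of the norm of
  \<open>\<parallel>y\<parallel>\<^sup>2 x - (x, y) y\<close>, the denominator-free component of \<open>x\<close> orthogonal to \<open>y\<close>.\<close>

lemma cauchy_schwarz: "cmod (cinner x y) \<le> norm (x::'a::complex_inner) * norm y"
proof (cases "y = 0")
  case False
  define c where "c = cinner x y"
  define n where "n = (norm y)\<^sup>2"
  have n: "n > 0" using False by (simp add: n_def)
  define v where "v = complex_of_real n *\<^sub>C x - c *\<^sub>C y"
  have yx: "cinner y x = cnj c" unfolding c_def by (rule cinner_commute)
  have "cinner v v = n\<^sup>2 * (norm x)\<^sup>2 - n * (c * cnj c)"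
    unfolding v_def cinner_expand cinner_self[of x] cinner_self[of y] yx c_def[symmetric] n_def[symmetric]
    by (simp add: power2_eq_square algebra_simps)
  then have "cinner v v = complex_of_real (n\<^sup>2 * (norm x)\<^sup>2 - n * (cmod c)\<^sup>2)"
    by (simp add: of_real_cmod_square)
  then have "n\<^sup>2 * (norm x)\<^sup>2 - n * (cmod c)\<^sup>2 \<ge> 0"
    by (metis Re_complex_of_real norm_square_cinner zero_le_power2)
  then have "n * (cmod c)\<^sup>2 \<le> n * (n * (norm x)\<^sup>2)" by (simp add: power2_eq_square algebra_simps)
  then have "(cmod c)\<^sup>2 \<le> (norm x * norm y)\<^sup>2"
    using n by (simp add: n_def power_mult_distrib mult.commute)
  then show ?thesis unfolding c_def by (rule power2_le_imp_le) simp
qed simp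

lemma bounded_bilinear_cinner: "bounded_bilinear (cinner :: 'a::complex_inner \<Rightarrow> 'a \<Rightarrow> complex)"
proof
  show "cinner (r *\<^sub>R x) y = r *\<^sub>R cinner x y" "cinner x (r *\<^sub>R y) = r *\<^sub>R cinner x y"
    for r and x y :: 'a
    by (simp_all add: scaleR_scaleC cinner_scaleC_left cinner_scaleC_right scaleC_complex_def)
  show "\<exists>K. \<forall>x y :: 'a. norm (cinner x y) \<le> norm x * norm y * K"
    by (intro exI[of _ 1]) (simp add: cauchy_schwarz)
qed (simp_all add: cinner_add_left cinner_add_right)

lemmas tendsto_cinner = bounded_bilinear.tendsto[OF bounded_bilinear_cinner]
lemmas continuous_on_cinner = bounded_bilinear.continuous_on[OF bounded_bilinear_cinner]

lemma bounded_linear_scaleC: "bounded_linear (\<lambda>x::'a::complex_inner. a *\<^sub>C x)"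
proof (rule bounded_linear_intro[where K = "cmod a"])
  show "a *\<^sub>C r *\<^sub>R x = r *\<^sub>R a *\<^sub>C x" for r and x :: 'a
    by (simp add: scaleR_scaleC scaleC_scaleC mult.commute)
qed (simp_all add: scaleC_add_right norm_scaleC mult.commute)

lemma subspace_scaleR:
  "complex_vector.subspace S \<Longrightarrow> x \<in> S \<Longrightarrow> r *\<^sub>R x \<in> S"
  by (simp add: scaleR_scaleC complex_vector.subspace_scale)

lemma parallelogram_law:
  "(norm (x + y))\<^sup>2 + (norm (x - y))\<^sup>2 = 2 * (norm x)\<^sup>2 + 2 * (norm (y::'a::complex_inner))\<^sup>2"
  unfolding norm_square_cinner by (simp add: cinner_expand)

text \<open>The projection is the point of \<open>M\<close> nearest to \<open>x\<close>. It is the limit of a minimising sequence,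
  and if \<open>x - y\<close> were not orthogonal to some \<open>m \<in> M\<close>, moving \<open>y\<close> along \<open>m\<close> would bring it closer.\<close>

lemma orthogonal_projection:
  fixes M :: "'a::chilbert_space set"
  assumes M: "complex_vector.subspace M" "closed M"
  obtains y where "y \<in> M" "\<And>m. m \<in> M \<Longrightarrow> cinner m (x - y) = 0"
proof -
  define d where "d = Inf ((\<lambda>m. (norm (x - m))\<^sup>2) ` M)"
  have M0: "M \<noteq> {}" using M complex_vector.subspace_0 by blast
  have bdd: "bdd_below ((\<lambda>m. (norm (x - m))\<^sup>2) ` M)" by (rule bdd_belowI[of _ 0]) auto
  have dle: "d \<le> (norm (x - m))\<^sup>2" if "m \<in> M" for m
    unfolding d_def using bdd that by (intro cInf_lower) auto
  have "\<exists>m\<in>M. (norm (x - m))\<^sup>2 < d + e" if "e > 0" for e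
    using cInf_lessD[of "(\<lambda>m. (norm (x - m))\<^sup>2) ` M" "d + e"] M0 that by (auto simp: d_def)
  then have "\<exists>m. m \<in> M \<and> (norm (x - m))\<^sup>2 < d + 1 / real (Suc n)" for n
    using of_nat_0_less_iff[of "Suc n"] zero_less_Suc by (metis zero_less_divide_1_iff)
  then obtain u where u: "\<And>n. u n \<in> M" "\<And>n. (norm (x - u n))\<^sup>2 < d + 1 / real (Suc n)"
    by metis
  \<comment> \<open>The midpoint of two nearly minimising points lies in \<open>M\<close>, so the parallelogram law bounds their distance.\<close>
  have close: "(norm (u m - u n))\<^sup>2 \<le> 2 / real (Suc m) + 2 / real (Suc n)" for m n
  proof -
    have "(1/2) *\<^sub>R (u m + u n) \<in> M"
      using M u by (simp add: subspace_scaleR complex_vector.subspace_add)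
    then have "d \<le> (norm (x - (1/2) *\<^sub>R (u m + u n)))\<^sup>2" by (rule dle)
    moreover have "(x - u n) + (x - u m) = 2 *\<^sub>R (x - (1/2) *\<^sub>R (u m + u n))"
      by (simp add: algebra_simps scaleR_2)
    then have "(norm ((x - u n) + (x - u m)))\<^sup>2 = 4 * (norm (x - (1/2) *\<^sub>R (u m + u n)))\<^sup>2"
      by (simp add: power_mult_distrib)
    moreover have "(x - u n) - (x - u m) = u m - u n" by simp
    ultimately show ?thesis
      using parallelogram_law[of "x - u n" "x - u m"] u(2)[of m] u(2)[of n] by simp
  qed
  have "Cauchy u"
  proof (rule metric_CauchyI)
    fix e :: real assume e: "e > 0"
    obtain N :: nat where N: "4 / e\<^sup>2 < real N" using reals_Archimedean2 by blast
    have "dist (u m) (u n) < e" if "m \<ge> N" "n \<ge> N" for m n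
    proof -
      have N0: "real N > 0" using N e by (smt (verit) divide_pos_pos zero_less_power)
      have "2 / real (Suc k) < 2 / real N" if "k \<ge> N" for k
        using that N0 by (intro divide_strict_left_mono) auto
      from this[of m] this[of n] have "(norm (u m - u n))\<^sup>2 < 4 / real N"
        using close[of m n] that by simp
      also have "\<dots> < e\<^sup>2" using N N0 e by (simp add: field_simps)
      finally show ?thesis using e by (simp add: dist_norm power_less_imp_less_base)
    qed
    then show "\<exists>N. \<forall>m\<ge>N. \<forall>n\<ge>N. dist (u m) (u n) < e" by blast
  qed
  then obtain y where y: "u \<longlonglongrightarrow> y" using Cauchy_convergent convergent_def by blast
  have yM: "y \<in> M" using M(2) u(1) y by (rule closed_sequentially)
  have "(\<lambda>n. d + 1 / real (Suc n)) \<longlonglongrightarrow> d + 0"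
    by (intro tendsto_intros LIMSEQ_inverse_real_of_nat[unfolded inverse_eq_divide])
  moreover have "(\<lambda>n. (norm (x - u n))\<^sup>2) \<longlonglongrightarrow> (norm (x - y))\<^sup>2" by (intro tendsto_intros y)
  ultimately have ymin: "(norm (x - y))\<^sup>2 \<le> d"
    using u(2) by (intro LIMSEQ_le) (auto intro!: less_imp_le)
  have "cinner m (x - y) = 0" if m: "m \<in> M" for m
  proof (rule ccontr)
    assume ne: "cinner m (x - y) \<noteq> 0"
    define v where "v = x - y"
    define c where "c = cinner v m"
    have m0: "norm m > 0" using ne by auto
    have c0: "c \<noteq> 0" using ne cinner_commute[of v m] by (auto simp: c_def v_def)
    \<comment> \<open>The minimiser of the distance from \<open>v\<close> to the complex line through \<open>m\<close>.\<close>
    define t where "t = c / complex_of_real ((norm m)\<^sup>2)"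
    have "y + t *\<^sub>C m \<in> M"
      using M m yM by (simp add: complex_vector.subspace_add complex_vector.subspace_scale)
    then have "d \<le> (norm (v - t *\<^sub>C m))\<^sup>2" using dle[of "y + t *\<^sub>C m"] by (simp add: v_def algebra_simps)
    moreover have "cinner (v - t *\<^sub>C m) (v - t *\<^sub>C m)
        = complex_of_real ((norm v)\<^sup>2 - (cmod c)\<^sup>2 / (norm m)\<^sup>2)"
    proof -
      have "cinner m v = cnj c" unfolding c_def by (rule cinner_commute)
      then have "cinner (v - t *\<^sub>C m) (v - t *\<^sub>C m)
        = (norm v)\<^sup>2 - cnj t * c - t * cnj c + t * cnj t * (norm m)\<^sup>2"
        by (simp add: cinner_expand cinner_self[of v] cinner_self[of m] c_def[symmetric] algebra_simps)
      also have "\<dots> = (norm v)\<^sup>2 - c * cnj c / (norm m)\<^sup>2"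
        using m0 by (simp add: t_def field_simps)
      finally show ?thesis by (simp add: of_real_cmod_square)
    qed
    then have "(norm (v - t *\<^sub>C m))\<^sup>2 = (norm v)\<^sup>2 - (cmod c)\<^sup>2 / (norm m)\<^sup>2"
      by (metis Re_complex_of_real norm_square_cinner)
    moreover have "(cmod c)\<^sup>2 / (norm m)\<^sup>2 > 0" using c0 m0 by simp
    ultimately show False using ymin by (simp add: v_def)
  qed
  then show ?thesis using that yM by blast
qed

lemma closure_subspace:
  fixes M :: "'a::complex_inner set"
  assumes M: "complex_vector.subspace M"
  shows "complex_vector.subspace (closure M)"
proof (rule complex_vector.subspaceI)
  show "0 \<in> closure M" using M complex_vector.subspace_0 closure_subset by blast
next
  fix x y assume "x \<in> closure M" "y \<in> closure M"
  then obtain a b where "\<And>n. a n \<in> M" "a \<longlonglongrightarrow> x" "\<And>n. b n \<in> M" "b \<longlonglongrightarrow> y"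
    unfolding closure_sequential by auto
  then have "(\<lambda>n. a n + b n) \<longlonglongrightarrow> x + y" "\<forall>n. a n + b n \<in> M"
    using M by (auto intro!: tendsto_add complex_vector.subspace_add)
  then show "x + y \<in> closure M" unfolding closure_sequential by (intro exI conjI)
next
  fix c x assume "x \<in> closure M"
  then obtain a where "\<And>n. a n \<in> M" "a \<longlonglongrightarrow> x" unfolding closure_sequential by auto
  then have "(\<lambda>n. c *\<^sub>C a n) \<longlonglongrightarrow> c *\<^sub>C x" "\<forall>n. c *\<^sub>C a n \<in> M"
    using M by (auto intro!: bounded_linear.tendsto[OF bounded_linear_scaleC] complex_vector.subspace_scale)
  then show "c *\<^sub>C x \<in> closure M" unfolding closure_sequential by (intro exI conjI)
qed

lemma closure_eq_UNIV_if_orthogonal_trivial: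
  fixes M :: "'a::chilbert_space set"
  assumes "complex_vector.subspace M" "\<And>x. (\<And>m. m \<in> M \<Longrightarrow> cinner m x = 0) \<Longrightarrow> x = 0"
  shows "closure M = UNIV"
proof -
  have "x \<in> closure M" for x
  proof -
    obtain y where y: "y \<in> closure M" "\<And>m. m \<in> closure M \<Longrightarrow> cinner m (x - y) = 0"
      using orthogonal_projection[OF closure_subspace[OF assms(1)]] by blast
    then have "x - y = 0" using assms(2) closure_subset by blast
    then show ?thesis using y by simp
  qed
  then show ?thesis by blast
qed

lemma eq_0_if_orthogonal_dense:
  fixes M :: "'a::complex_inner set"
  assumes "closure M = UNIV" "\<And>m. m \<in> M \<Longrightarrow> cinner m x = 0"
  shows "x = 0"
proof -
  have "closed {m. cinner m x = 0}"
    by (intro closed_Collect_eq continuous_on_cinner continuous_intros)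
  then have "closure M \<subseteq> {m. cinner m x = 0}" using assms(2) by (intro closure_minimal) auto
  then have "x \<in> {m. cinner m x = 0}" using assms(1) by blast
  then have "cinner x x = 0" by blast
  then show ?thesis by simp
qed

section \<open>Linear operators as graphs\<close>

lemma pair_diff_subspace:
  "complex_vector.subspace T \<Longrightarrow> (f, h) \<in> T \<Longrightarrow> (f', h') \<in> T \<Longrightarrow> (f - f', h - h') \<in> T"
  using complex_vector.subspace_diff[of T "(f, h)" "(f', h')"] by simp

lemma pair_add_subspace:
  "complex_vector.subspace T \<Longrightarrow> (f, h) \<in> T \<Longrightarrow> (f', h') \<in> T \<Longrightarrow> (f + f', h + h') \<in> T"
  using complex_vector.subspace_add[of T "(f, h)" "(f', h')"] by simp

lemma pair_scale_subspace:
  "complex_vector.subspace T \<Longrightarrow> (f, h) \<in> T \<Longrightarrow> (a *\<^sub>C f, a *\<^sub>C h) \<in> T"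
  using complex_vector.subspace_scale[of T "(f, h)" a] by (simp add: scaleC_prod_def)

lemma subspace_Domain:
  assumes T: "complex_vector.subspace T" shows "complex_vector.subspace (Domain T)"
proof (rule complex_vector.subspaceI)
  show "0 \<in> Domain T"
    using complex_vector.subspace_0[OF T] unfolding zero_prod_def by (rule DomainI)
next
  fix p q assume "p \<in> Domain T" "q \<in> Domain T"
  then obtain p' q' where "(p, p') \<in> T" "(q, q') \<in> T" by (elim DomainE)
  then show "p + q \<in> Domain T" by (rule DomainI[OF pair_add_subspace[OF T]])
next
  fix c p assume "p \<in> Domain T"
  then obtain p' where "(p, p') \<in> T" by (rule DomainE)
  then show "c *\<^sub>C p \<in> Domain T" by (rule DomainI[OF pair_scale_subspace[OF T]])
qed

lemma subspace_converse:
  assumes T: "complex_vector.subspace T" shows "complex_vector.subspace (T\<inverse>)"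
proof (rule complex_vector.subspaceI)
  show "0 \<in> T\<inverse>"
    using complex_vector.subspace_0[OF T] unfolding zero_prod_def by (rule converseI)
  fix u v assume "u \<in> T\<inverse>" "v \<in> T\<inverse>"
  then show "u + v \<in> T\<inverse>" by (cases u; cases v) (simp add: pair_add_subspace[OF T])
next
  fix c u assume "u \<in> T\<inverse>"
  then show "c *\<^sub>C u \<in> T\<inverse>" by (cases u) (simp add: scaleC_prod_def pair_scale_subspace[OF T])
qed

lemma mem_adjoint: "(g, h) \<in> adjoint_op T \<longleftrightarrow> (\<forall>f f'. (f, f') \<in> T \<longrightarrow> cinner f' g = cinner f h)"
  by (auto simp: adjoint_in_def)

lemma mem_deficiency_space: "f \<in> deficiency_space T z \<longleftrightarrow> (f, z *\<^sub>C f) \<in> adjoint_op T"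
  by (auto simp: deficiency_space_def kernel_op_def affine_op_def scaleC_one)

lemma adjoint_subspace: "complex_vector.subspace (adjoint_op T)"
  by (rule complex_vector.subspaceI)
    (auto simp: mem_adjoint cinner_expand scaleC_prod_def zero_prod_def)

lemma adjoint_antimono: "T \<subseteq> T' \<Longrightarrow> adjoint_op T' \<subseteq> adjoint_op T"
  by (auto simp: adjoint_in_def)

lemma closed_adjoint: "closed (adjoint_op T)"
proof -
  have "adjoint_op T = (\<Inter>p\<in>T. {q. cinner (snd p) (fst q) = cinner (fst p) (snd q)})"
    by (fastforce simp: adjoint_in_def)
  then show ?thesis
    by (auto intro!: closed_INT closed_Collect_eq continuous_on_cinner continuous_intros)
qed

text \<open>The range of \<open>T - z\<close>, for a closed \<open>T\<close> on which \<open>T - z\<close> is bounded below: preimages of a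
  convergent sequence are Cauchy, and so are their images under \<open>T\<close>.\<close>

lemma closed_range_shift:
  fixes T :: "'a::chilbert_space operator"
  assumes T: "complex_vector.subspace T" "closed T" and c: "c > 0"
    and bound: "\<And>f h. (f, h) \<in> T \<Longrightarrow> c * norm f \<le> norm (h - z *\<^sub>C f)"
  shows "closed {h - z *\<^sub>C f |f h. (f, h) \<in> T}"
  unfolding closed_sequential_limits
proof (intro allI impI, elim conjE)
  fix x l assume x: "\<forall>n. x n \<in> {h - z *\<^sub>C f |f h. (f, h) \<in> T}" and l: "x \<longlonglongrightarrow> l"
  have "\<exists>f h. (f, h) \<in> T \<and> x n = h - z *\<^sub>C f" for n using x by blast
  then obtain f h where fh: "\<And>n. (f n, h n) \<in> T" "\<And>n. x n = h n - z *\<^sub>C f n" by metis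
  have "Cauchy x" using l LIMSEQ_imp_Cauchy by blast
  have "Cauchy f"
  proof (rule metric_CauchyI)
    fix e :: real assume "e > 0"
    then obtain N where N: "\<And>m n. m \<ge> N \<Longrightarrow> n \<ge> N \<Longrightarrow> dist (x m) (x n) < c * e"
      using metric_CauchyD[OF \<open>Cauchy x\<close>, of "c * e"] c by auto
    have "dist (f m) (f n) < e" if "m \<ge> N" "n \<ge> N" for m n
    proof -
      have "c * norm (f m - f n) \<le> norm ((h m - h n) - z *\<^sub>C (f m - f n))"
        using bound pair_diff_subspace[OF T(1) fh(1) fh(1)] by blast
      also have "(h m - h n) - z *\<^sub>C (f m - f n) = x m - x n"
        by (simp add: fh(2) complex_vector.scale_right_diff_distrib)
      also have "norm (x m - x n) < c * e" using N that by (simp add: dist_norm)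
      finally show ?thesis using c by (simp add: dist_norm)
    qed
    then show "\<exists>N. \<forall>m\<ge>N. \<forall>n\<ge>N. dist (f m) (f n) < e" by blast
  qed
  then obtain f0 where f0: "f \<longlonglongrightarrow> f0" using Cauchy_convergent convergent_def by blast
  have "(\<lambda>n. x n + z *\<^sub>C f n) \<longlonglongrightarrow> l + z *\<^sub>C f0"
    by (intro tendsto_intros l bounded_linear.tendsto[OF bounded_linear_scaleC] f0)
  then have "h \<longlonglongrightarrow> l + z *\<^sub>C f0" by (simp add: fh(2))
  then have "(\<lambda>n. (f n, h n)) \<longlonglongrightarrow> (f0, l + z *\<^sub>C f0)" by (intro tendsto_Pair f0)
  with fh(1) have "(f0, l + z *\<^sub>C f0) \<in> T"
    by (rule closed_sequentially[OF T(2)])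
  moreover have "l = (l + z *\<^sub>C f0) - z *\<^sub>C f0" by simp
  ultimately show "l \<in> {h - z *\<^sub>C f |f h. (f, h) \<in> T}" by blast
qed

lemma subspace_range_shift:
  fixes T :: "'a::complex_vector operator"
  assumes "complex_vector.subspace T"
  shows "complex_vector.subspace {h - z *\<^sub>C f |f h. (f, h) \<in> T}"
proof (rule complex_vector.subspaceI)
  have "(0, 0) \<in> T" using assms complex_vector.subspace_0 by (metis zero_prod_def)
  then show "0 \<in> {h - z *\<^sub>C f |f h. (f, h) \<in> T}" by (intro CollectI exI[of _ 0]) simp
next
  fix x y assume "x \<in> {h - z *\<^sub>C f |f h. (f, h) \<in> T}" "y \<in> {h - z *\<^sub>C f |f h. (f, h) \<in> T}"
  then obtain f h f' h' where "(f, h) \<in> T" "(f', h') \<in> T" "x = h - z *\<^sub>C f" "y = h' - z *\<^sub>C f'"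
    by blast
  then have "(f + f', h + h') \<in> T" "x + y = (h + h') - z *\<^sub>C (f + f')"
    using assms by (auto simp: pair_add_subspace scaleC_add_right)
  then show "x + y \<in> {h - z *\<^sub>C f |f h. (f, h) \<in> T}" by blast
next
  fix c x assume "x \<in> {h - z *\<^sub>C f |f h. (f, h) \<in> T}"
  then obtain f h where "(f, h) \<in> T" "x = h - z *\<^sub>C f" by blast
  then have "(c *\<^sub>C f, c *\<^sub>C h) \<in> T" "c *\<^sub>C x = c *\<^sub>C h - z *\<^sub>C (c *\<^sub>C f)"
    using assms by (auto simp: pair_scale_subspace complex_vector.scale_right_diff_distrib
        scaleC_scaleC mult.commute)
  then show "c *\<^sub>C x \<in> {h - z *\<^sub>C f |f h. (f, h) \<in> T}" by blast
qed

text \<open>The imaginary part of \<open>((T - z) f, f)\<close> is \<open>- Im z\<close> times the square of the norm of \<open>f\<close>.\<close>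

lemma symmetric_shift_bound:
  assumes "symmetric_op T" "(f, h) \<in> T"
  shows "\<bar>Im z\<bar> * norm f \<le> norm (h - z *\<^sub>C f)"
proof -
  have "cinner h f = cinner f h" using assms by (force simp: symmetric_op_def)
  then have "Im (cinner h f) = 0"
    using arg_cong[OF cinner_commute[of f h], of Im] by simp
  then have "Im (cinner (h - z *\<^sub>C f) f) = - Im z * (norm f)\<^sup>2"
    by (simp add: cinner_expand cinner_self)
  then have "\<bar>Im z\<bar> * (norm f)\<^sup>2 \<le> norm (h - z *\<^sub>C f) * norm f"
    using abs_Im_le_cmod[of "cinner (h - z *\<^sub>C f) f"] cauchy_schwarz[of "h - z *\<^sub>C f" f]
    by (simp add: abs_mult)
  then have "(\<bar>Im z\<bar> * norm f) * norm f \<le> norm (h - z *\<^sub>C f) * norm f"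
    by (simp add: power2_eq_square mult.assoc)
  then show ?thesis by (cases "f = 0") auto
qed

lemma selfadjoint_symmetric: "selfadjoint T \<Longrightarrow> symmetric_op T"
  unfolding selfadjoint_in_def symmetric_op_def using mem_adjoint[of _ _ T] by auto

text \<open>A vector orthogonal to the range of \<open>T - z\<close> is an eigenvector of \<open>T\<^sup>* = T\<close> for the nonreal
  eigenvalue conjugate to \<open>z\<close>, which a symmetric operator does not have.\<close>

lemma selfadjoint_shift_surj:
  fixes T :: "'a::chilbert_space operator"
  assumes T: "selfadjoint T" and z: "Im z \<noteq> 0"
  obtains f h where "(f, h) \<in> T" "h - z *\<^sub>C f = x"
proof -
  have sub: "complex_vector.subspace T" and adj: "adjoint_op T = T"
    using T by (auto simp: selfadjoint_in_def linear_operator_def)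
  have sym: "symmetric_op T" using T by (rule selfadjoint_symmetric)
  define R where "R = {h - z *\<^sub>C f |f h. (f, h) \<in> T}"
  have "closed T" using closed_adjoint[of T] unfolding adj .
  moreover have "\<bar>Im z\<bar> > 0" using z by simp
  ultimately have "closed R"
    unfolding R_def using symmetric_shift_bound[OF sym] by (rule closed_range_shift[OF sub])
  moreover have "complex_vector.subspace R" unfolding R_def by (rule subspace_range_shift[OF sub])
  ultimately obtain y where y: "y \<in> R" "\<And>m. m \<in> R \<Longrightarrow> cinner m (x - y) = 0"
    using orthogonal_projection by metis
  have "(x - y, cnj z *\<^sub>C (x - y)) \<in> adjoint_op T"
  proof (unfold mem_adjoint, intro allI impI)
    fix f h assume "(f, h) \<in> T"
    then have "cinner (h - z *\<^sub>C f) (x - y) = 0" using y(2) R_def by blast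
    then show "cinner h (x - y) = cinner f (cnj z *\<^sub>C (x - y))"
      by (simp only: cinner_diff_left cinner_scaleC_left cinner_scaleC_right) simp
  qed
  then have "\<bar>Im (cnj z)\<bar> * norm (x - y) \<le> norm (cnj z *\<^sub>C (x - y) - cnj z *\<^sub>C (x - y))"
    using symmetric_shift_bound[OF sym] adj by blast
  then have xy: "x = y" using z by (simp add: mult_le_0_iff)
  obtain f h where "(f, h) \<in> T" "y = h - z *\<^sub>C f" using y(1) unfolding R_def by blast
  then show ?thesis by (intro that[of f h]) (simp_all add: xy)
qed

text \<open>Deficiency index one enters only in this form: every deficiency vector is a multiple of a
  chosen one.\<close>

lemma dim_one_span:
  assumes "complex_vector.dim V = 1" "g \<in> V" "g \<noteq> 0" "x \<in> V"
  obtains c where "x = c *\<^sub>C g"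
proof -
  obtain B where B: "B \<subseteq> V" "V \<subseteq> complex_vector.span B"
      and card: "card B = complex_vector.dim V"
    by (rule complex_vector.basis_exists)
  obtain b where b: "B = {b}" using card unfolding assms(1) by (rule card_1_singletonE)
  have V: "V \<subseteq> range (\<lambda>k. k *\<^sub>C b)"
    using B(2) unfolding b complex_vector.span_singleton .
  obtain s where s: "g = s *\<^sub>C b" using subsetD[OF V assms(2)] by (rule rangeE)
  obtain t where t: "x = t *\<^sub>C b" using subsetD[OF V assms(4)] by (rule rangeE)
  have "s \<noteq> 0" using s assms(3) by auto
  then have "x = (t / s) *\<^sub>C g" by (simp add: s t scaleC_scaleC)
  then show ?thesis by (rule that)
qed

lemma adjoint_single_valued:
  assumes "densely_defined T" shows "single_valued (adjoint_op T)"
proof (rule single_valuedI)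
  fix x y y' assume a: "(x, y) \<in> adjoint_op T" "(x, y') \<in> adjoint_op T"
  have "cinner f (y - y') = 0" if "f \<in> Domain T" for f
    using that a by (auto simp: mem_adjoint cinner_diff_right)
  moreover have "closure (Domain T) = UNIV" using assms by (auto simp: densely_defined_in_def)
  ultimately have "y - y' = 0" by (intro eq_0_if_orthogonal_dense[of "Domain T"])
  then show "y = y'" by simp
qed

section \<open>Boundary coefficients of a symmetric operator with deficiency indices (1,1)\<close>

text \<open>With \<open>g = g\<^sub>+\<close>, respectively \<open>g = g\<^sub>-\<close>, these functionals give the coefficients \<open>a\<close> and \<open>b\<close> in the
  von Neumann decomposition \<open>x = f + a g\<^sub>+ + b g\<^sub>-\<close> with \<open>f\<close> in the domain of the symmetric
  operator; \<open>x'\<close> stands for the image of \<open>x\<close> under the adjoint. Up to a factor they are the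
  Lagrange brackets of \<open>x\<close> with \<open>g\<^sub>+\<close> and \<open>g\<^sub>-\<close>, which is why they need no choice of \<open>f\<close> and are
  preserved by unitary maps.\<close>

definition plus_coeff :: "'a::complex_inner \<Rightarrow> 'a \<Rightarrow> 'a \<Rightarrow> complex"
  where "plus_coeff g x x' = (cinner x' g + \<i> * cinner x g) / (2 * \<i>)"

definition minus_coeff :: "'a::complex_inner \<Rightarrow> 'a \<Rightarrow> 'a \<Rightarrow> complex"
  where "minus_coeff g x x' = (\<i> * cinner x g - cinner x' g) / (2 * \<i>)"

lemma plus_coeff_linear:
  "plus_coeff g (x + y) (x' + y') = plus_coeff g x x' + plus_coeff g y y'"
  "plus_coeff g (x - y) (x' - y') = plus_coeff g x x' - plus_coeff g y y'"
  "plus_coeff g (c *\<^sub>C x) (c *\<^sub>C x') = c * plus_coeff g x x'"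
  by (simp_all add: plus_coeff_def cinner_expand algebra_simps add_divide_distrib diff_divide_distrib)

lemma minus_coeff_linear:
  "minus_coeff g (x + y) (x' + y') = minus_coeff g x x' + minus_coeff g y y'"
  "minus_coeff g (x - y) (x' - y') = minus_coeff g x x' - minus_coeff g y y'"
  "minus_coeff g (c *\<^sub>C x) (c *\<^sub>C x') = c * minus_coeff g x x'"
  by (simp_all add: minus_coeff_def cinner_expand algebra_simps add_divide_distrib diff_divide_distrib)

lemma plus_coeff_eigen: "plus_coeff g x (z *\<^sub>C x) = (z + \<i>) * cinner x g / (2 * \<i>)"
  by (simp add: plus_coeff_def cinner_expand algebra_simps)

lemma minus_coeff_eigen: "minus_coeff g x (z *\<^sub>C x) = - ((z - \<i>) * cinner x g / (2 * \<i>))"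
  by (simp add: minus_coeff_def cinner_expand algebra_simps minus_divide_left)

locale deficiency_frame =
  fixes A0 A :: "'a::chilbert_space operator" and gp gm :: 'a
  assumes symmetric: "symmetric_op A0" and dense: "densely_defined A0" and closed_A0: "closed A0"
    and dim_plus: "complex_vector.dim (deficiency_space A0 \<i>) = 1"
    and dim_minus: "complex_vector.dim (deficiency_space A0 (- \<i>)) = 1"
    and extends: "A0 \<subseteq> A" and selfadjoint_A: "selfadjoint A"
    and frame: "deficiency_vectors A0 A gp gm"
begin

lemma A0_subspace: "complex_vector.subspace A0"
  using symmetric by (auto simp: symmetric_op_def linear_operator_def)

lemma A_subspace: "complex_vector.subspace A"
  using selfadjoint_A by (auto simp: selfadjoint_in_def linear_operator_def)

lemma A_adjoint: "adjoint_op A = A"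
  using selfadjoint_A by (auto simp: selfadjoint_in_def)

lemma A_symmetric: "symmetric_op A"
  by (rule selfadjoint_symmetric[OF selfadjoint_A])

lemma A_sub_adjoint: "A \<subseteq> adjoint_op A0"
  using adjoint_antimono[OF extends] A_adjoint by simp

lemma A0_sub_adjoint: "A0 \<subseteq> adjoint_op A0"
  using extends A_sub_adjoint by (rule subset_trans)

lemma A_cinner: "(f, h) \<in> A \<Longrightarrow> (f', h') \<in> A \<Longrightarrow> cinner h f' = cinner f h'"
  using mem_adjoint[of f' h' A] A_adjoint by simp

lemma adjoint_cinner: "(f, h) \<in> A0 \<Longrightarrow> (x, x') \<in> adjoint_op A0 \<Longrightarrow> cinner h x = cinner f x'"
  using mem_adjoint by blast

lemma adjoint_cinner': "(f, h) \<in> A0 \<Longrightarrow> (x, x') \<in> adjoint_op A0 \<Longrightarrow> cinner x' f = cinner x h"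
  using adjoint_cinner[of f h x x'] cinner_commute[of x' f] cinner_commute[of x h] by simp

lemma adjoint_unique: "(x, y) \<in> adjoint_op A0 \<Longrightarrow> (x, y') \<in> adjoint_op A0 \<Longrightarrow> y = y'"
  using adjoint_single_valued[OF dense] by (rule single_valuedD)

lemma frame_norm [simp]: "cinner gp gp = 1" "cinner gm gm = 1"
  using frame by (simp_all add: deficiency_vectors_def cinner_self)

lemma frame_nonzero: "gp \<noteq> 0" "gm \<noteq> 0"
  using frame_norm by fastforce+

lemma gp_adjoint: "(gp, \<i> *\<^sub>C gp) \<in> adjoint_op A0"
  using frame by (simp add: deficiency_vectors_def mem_deficiency_space)

lemma gm_adjoint: "(gm, (- \<i>) *\<^sub>C gm) \<in> adjoint_op A0"
  using frame by (simp add: deficiency_vectors_def mem_deficiency_space)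

lemma plus_space: "x \<in> deficiency_space A0 \<i> \<Longrightarrow> \<exists>c. x = c *\<^sub>C gp"
  using dim_one_span[OF dim_plus, of gp x] frame frame_nonzero
  by (metis deficiency_vectors_def)

lemma minus_space: "x \<in> deficiency_space A0 (- \<i>) \<Longrightarrow> \<exists>c. x = c *\<^sub>C gm"
  using dim_one_span[OF dim_minus, of gm x] frame frame_nonzero
  by (metis deficiency_vectors_def)

abbreviation bp where "bp \<equiv> plus_coeff gp"
abbreviation bm where "bm \<equiv> minus_coeff gm"

lemma bp_gp [simp]: "bp gp (\<i> *\<^sub>C gp) = 1" and bm_gp [simp]: "bm gp (\<i> *\<^sub>C gp) = 0"
  and bp_gm: "bp gm ((- \<i>) *\<^sub>C gm) = 0" and bm_gm: "bm gm ((- \<i>) *\<^sub>C gm) = 1"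
  unfolding plus_coeff_eigen minus_coeff_eigen by simp_all

lemma bp_A0: "(f, h) \<in> A0 \<Longrightarrow> bp f h = 0" and bm_A0: "(f, h) \<in> A0 \<Longrightarrow> bm f h = 0"
  using adjoint_cinner[OF _ gp_adjoint, of f h] adjoint_cinner[OF _ gm_adjoint, of f h]
  by (simp_all add: plus_coeff_def minus_coeff_def cinner_expand)

lemma bracket_gp: "cinner x' gp - cinner x (\<i> *\<^sub>C gp) = 2 * \<i> * bp x x'"
  and bracket_gm: "cinner x' gm - cinner x ((- \<i>) *\<^sub>C gm) = - 2 * \<i> * bm x x'"
  by (simp_all add: plus_coeff_def minus_coeff_def cinner_expand)

lemma frame_difference_in_A: "(gp - gm, \<i> *\<^sub>C gp - (- \<i>) *\<^sub>C gm) \<in> A"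
proof -
  obtain k where k: "(gp - gm, k) \<in> A" using frame by (auto simp: deficiency_vectors_def)
  have "(gp - gm, \<i> *\<^sub>C gp - (- \<i>) *\<^sub>C gm) \<in> adjoint_op A0"
    by (rule pair_diff_subspace[OF adjoint_subspace gp_adjoint gm_adjoint])
  then have "k = \<i> *\<^sub>C gp - (- \<i>) *\<^sub>C gm" using k A_sub_adjoint adjoint_unique by blast
  then show ?thesis using k by simp
qed

text \<open>The operator \<open>A\<close> is symmetric and its domain contains \<open>g\<^sub>+ - g\<^sub>-\<close>; the Lagrange bracket with
  that vector is a multiple of the sum of the two coefficients.\<close>

lemma coeffs_A: "(f, h) \<in> A \<Longrightarrow> bp f h + bm f h = 0"
proof -
  assume "(f, h) \<in> A"
  then have "cinner h (gp - gm) = cinner f (\<i> *\<^sub>C gp - (- \<i>) *\<^sub>C gm)"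
    by (rule A_cinner[OF _ frame_difference_in_A])
  then have "(cinner h gp - cinner f (\<i> *\<^sub>C gp)) - (cinner h gm - cinner f ((- \<i>) *\<^sub>C gm)) = 0"
    unfolding cinner_diff_right by (simp only: diff_eq_eq) (simp add: algebra_simps)
  then have "2 * \<i> * (bp f h + bm f h) = 0"
    unfolding bracket_gp bracket_gm by (simp add: algebra_simps)
  then show ?thesis by simp
qed

lemma A_shift_unique:
  assumes "(f, h) \<in> A" "(f', h') \<in> A" "h - z *\<^sub>C f = h' - z *\<^sub>C f'" "Im z \<noteq> 0"
  shows "f = f'" "h = h'"
proof -
  have "(f - f', h - h') \<in> A" by (rule pair_diff_subspace[OF A_subspace assms(1,2)])
  from symmetric_shift_bound[OF A_symmetric this, of z]
  have "\<bar>Im z\<bar> * norm (f - f') \<le> 0"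
    using assms(3) by (simp add: complex_vector.scale_right_diff_distrib algebra_simps)
  then show "f = f'" using assms(4) by (simp add: mult_le_0_iff)
  then show "h = h'" using assms(3) by simp
qed

text \<open>The coefficient of \<open>(f, h)\<close> vanishes exactly if \<open>h + i f\<close> is orthogonal to \<open>g\<^sub>+\<close>, which spans the
  orthogonal complement of the range of \<open>A0 + i\<close>. This range is closed, so it contains \<open>h + i f\<close>,
  and the solution \<open>f\<^sub>0\<close> of \<open>(A0 + i) f\<^sub>0 = h + i f\<close> must be \<open>f\<close> because \<open>A + i\<close> is injective.\<close>

lemma A0_if_plus_coeff_zero:
  assumes "(f, h) \<in> A" "bp f h = 0"
  shows "(f, h) \<in> A0"
proof -
  define R where "R = {h - (- \<i>) *\<^sub>C f |f h. (f, h) \<in> A0}"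
  have "closed R" unfolding R_def
  proof (rule closed_range_shift[OF A0_subspace closed_A0, of 1])
    show "1 * norm f \<le> norm (h - (- \<i>) *\<^sub>C f)" if "(f, h) \<in> A0" for f h
      using symmetric_shift_bound[OF symmetric that, of "- \<i>"] by simp
  qed simp
  moreover have "complex_vector.subspace R" unfolding R_def by (rule subspace_range_shift[OF A0_subspace])
  ultimately obtain y where y: "y \<in> R" "\<And>m. m \<in> R \<Longrightarrow> cinner m ((h - (- \<i>) *\<^sub>C f) - y) = 0"
    using orthogonal_projection by metis
  obtain f0 h0 where f0: "(f0, h0) \<in> A0" "y = h0 - (- \<i>) *\<^sub>C f0" using y(1) unfolding R_def by blast
  define w where "w = (h - (- \<i>) *\<^sub>C f) - y"
  have "(w, \<i> *\<^sub>C w) \<in> adjoint_op A0"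
  proof (unfold mem_adjoint, intro allI impI)
    fix f' h' assume "(f', h') \<in> A0"
    then have "cinner (h' - (- \<i>) *\<^sub>C f') w = 0" using y(2) unfolding R_def w_def by blast
    then show "cinner h' w = cinner f' (\<i> *\<^sub>C w)" by (simp add: cinner_expand eq_neg_iff_add_eq_0)
  qed
  then have "w \<in> deficiency_space A0 \<i>" unfolding mem_deficiency_space .
  then obtain c where c: "w = c *\<^sub>C gp" using plus_space by blast
  have wA: "w = (h - h0) - (- \<i>) *\<^sub>C (f - f0)"
    by (simp add: w_def f0(2) complex_vector.scale_right_diff_distrib)
  have "bp (f - f0) (h - h0) = 0" using assms(2) bp_A0[OF f0(1)] by (simp add: plus_coeff_linear)
  then have "cinner w gp = 0" unfolding wA by (simp add: plus_coeff_def cinner_expand)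
  then have "w = 0" using c by (simp add: cinner_expand)
  then have "h - (- \<i>) *\<^sub>C f = h0 - (- \<i>) *\<^sub>C f0" by (simp add: w_def f0(2))
  then have "f = f0" "h = h0" using A_shift_unique[of f h f0 h0 "- \<i>"] assms(1) f0(1) extends by auto
  then show ?thesis using f0(1) by simp
qed

text \<open>Subtracting the element \<open>q\<close> of the domain of \<open>A\<close> with \<open>(A + i) q = x' + i x\<close> leaves a multiple of
  \<open>g\<^sub>-\<close>; subtracting from \<open>q\<close> a multiple of \<open>g\<^sub>+ - g\<^sub>-\<close> makes its coefficient vanish.\<close>

lemma von_Neumann_decomposition:
  assumes x: "(x, x') \<in> adjoint_op A0"
  shows "(x - bp x x' *\<^sub>C gp - bm x x' *\<^sub>C gm,
      x' - bp x x' *\<^sub>C \<i> *\<^sub>C gp - bm x x' *\<^sub>C (- \<i>) *\<^sub>C gm) \<in> A0"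
proof -
  have "Im (- \<i>) \<noteq> 0" by simp
  then obtain q q' where q: "(q, q') \<in> A" "q' - (- \<i>) *\<^sub>C q = x' - (- \<i>) *\<^sub>C x"
    by (rule selfadjoint_shift_surj[OF selfadjoint_A])
  have d: "(x - q, x' - q') \<in> adjoint_op A0"
    using pair_diff_subspace[OF adjoint_subspace x] q(1) A_sub_adjoint by blast
  have e: "x' - q' = (- \<i>) *\<^sub>C (x - q)"
    using q(2) by (simp add: complex_vector.scale_right_diff_distrib algebra_simps)
  have "x - q \<in> deficiency_space A0 (- \<i>)" using d unfolding mem_deficiency_space e .
  then obtain c where c: "x - q = c *\<^sub>C gm" using minus_space by blast
  define a where "a = bp q q'"
  have "(q - a *\<^sub>C (gp - gm), q' - a *\<^sub>C (\<i> *\<^sub>C gp - (- \<i>) *\<^sub>C gm)) \<in> A"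
    by (rule pair_diff_subspace[OF A_subspace q(1) pair_scale_subspace[OF A_subspace frame_difference_in_A]])
  moreover have "bp (q - a *\<^sub>C (gp - gm)) (q' - a *\<^sub>C (\<i> *\<^sub>C gp - (- \<i>) *\<^sub>C gm)) = 0"
    by (simp only: plus_coeff_linear bp_gp bp_gm a_def) simp
  ultimately have r: "(q - a *\<^sub>C (gp - gm), q' - a *\<^sub>C (\<i> *\<^sub>C gp - (- \<i>) *\<^sub>C gm)) \<in> A0"
    by (rule A0_if_plus_coeff_zero)
  have x_eq: "x = q + c *\<^sub>C gm" using c by (simp add: algebra_simps)
  have x'_eq: "x' = q' + c *\<^sub>C (- \<i>) *\<^sub>C gm"
  proof -
    have "x' - q' = c *\<^sub>C (- \<i>) *\<^sub>C gm" unfolding e c scaleC_scaleC by (simp only: mult.commute)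
    then show ?thesis by (metis add.commute diff_add_cancel)
  qed
  have bp: "bp x x' = a"
    unfolding x_eq x'_eq by (simp only: plus_coeff_linear bp_gm a_def) simp
  have bm: "bm x x' = c - a"
    unfolding x_eq x'_eq using coeffs_A[OF q(1)]
    by (simp only: minus_coeff_linear bm_gm a_def) (simp add: eq_neg_iff_add_eq_0 add.commute)
  have "x - bp x x' *\<^sub>C gp - bm x x' *\<^sub>C gm = q - a *\<^sub>C (gp - gm)"
    unfolding bp bm by (simp add: x_eq complex_vector.scale_right_diff_distrib complex_vector.scale_left_diff_distrib)
  moreover have "x' - bp x x' *\<^sub>C \<i> *\<^sub>C gp - bm x x' *\<^sub>C (- \<i>) *\<^sub>C gm
      = q' - a *\<^sub>C (\<i> *\<^sub>C gp - (- \<i>) *\<^sub>C gm)"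
    unfolding bp bm by (simp add: x'_eq complex_vector.scale_right_diff_distrib
        complex_vector.scale_left_diff_distrib scaleC_add_right scaleC_scaleC left_diff_distrib)
  ultimately show ?thesis using r by simp
qed

lemma A0_iff: "(x, x') \<in> A0 \<longleftrightarrow> (x, x') \<in> adjoint_op A0 \<and> bp x x' = 0 \<and> bm x x' = 0"
  using von_Neumann_decomposition[of x x'] bp_A0 bm_A0 A0_sub_adjoint by auto

text \<open>Decompose \<open>y\<close> only: the part in the domain of \<open>A0\<close> contributes nothing, and the brackets with
  \<open>g\<^sub>+\<close> and \<open>g\<^sub>-\<close> are the coefficients of \<open>x\<close> by definition.\<close>

lemma Green_identity:
  assumes x: "(x, x') \<in> adjoint_op A0" and y: "(y, y') \<in> adjoint_op A0"
  shows "cinner x' y - cinner x y' = 2 * \<i> * (bp x x' * cnj (bp y y') - bm x x' * cnj (bm y y'))"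
proof -
  define c where "c = bp y y'"
  define d where "d = bm y y'"
  have "cinner x' (y - c *\<^sub>C gp - d *\<^sub>C gm)
      = cinner x (y' - c *\<^sub>C \<i> *\<^sub>C gp - d *\<^sub>C (- \<i>) *\<^sub>C gm)"
    unfolding c_def d_def by (rule adjoint_cinner'[OF von_Neumann_decomposition[OF y] x])
  then have "cinner x' y - cinner x y' = cnj c * (cinner x' gp - cinner x (\<i> *\<^sub>C gp))
      + cnj d * (cinner x' gm - cinner x ((- \<i>) *\<^sub>C gm))"
    by (simp add: cinner_expand algebra_simps)
  then show ?thesis unfolding bracket_gp bracket_gm c_def[symmetric] d_def[symmetric]
    by (simp add: algebra_simps)
qed

lemma Im_form:
  assumes "(x, x') \<in> adjoint_op A0"
  shows "Im (cinner x' x) = (cmod (bp x x'))\<^sup>2 - (cmod (bm x x'))\<^sup>2"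
proof -
  have "2 * \<i> * complex_of_real (Im (cinner x' x)) = cinner x' x - cinner x x'"
    by (subst cinner_commute[of x x']) (simp add: complex_eq_iff)
  also have "\<dots> = 2 * \<i> * complex_of_real ((cmod (bp x x'))\<^sup>2 - (cmod (bm x x'))\<^sup>2)"
    by (simp add: Green_identity[OF assms assms] of_real_cmod_square)
  finally show ?thesis by (simp only: mult_cancel_left of_real_eq_iff) simp
qed

lemma eigen_norm:
  assumes "v \<in> deficiency_space A0 z"
  shows "Im z * (norm v)\<^sup>2 = (cmod (bp v (z *\<^sub>C v)))\<^sup>2 - (cmod (bm v (z *\<^sub>C v)))\<^sup>2"
  using Im_form[of v "z *\<^sub>C v"] assms by (simp add: mem_deficiency_space cinner_scaleC_left cinner_self)

text \<open>This is the source of all estimates in the upper half-plane: a nonzero vector of the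
  deficiency space has a dominating \<open>g\<^sub>+\<close>-coefficient.\<close>

lemma minus_lt_plus:
  assumes "v \<in> deficiency_space A0 z" "Im z > 0" "v \<noteq> 0"
  shows "cmod (bm v (z *\<^sub>C v)) < cmod (bp v (z *\<^sub>C v))"
proof -
  have "Im z * (norm v)\<^sup>2 > 0" using assms by simp
  then have "(cmod (bm v (z *\<^sub>C v)))\<^sup>2 < (cmod (bp v (z *\<^sub>C v)))\<^sup>2"
    using eigen_norm[OF assms(1)] by simp
  then show ?thesis by (rule power_less_imp_less_base) simp
qed

subsection \<open>The resolvent of the self-adjoint extension\<close>

definition resolvent :: "complex \<Rightarrow> 'a \<Rightarrow> 'a"
  where "resolvent z x = (THE f. \<exists>h. (f, h) \<in> A \<and> h - z *\<^sub>C f = x)"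

lemma resolvent_eq:
  assumes "(f, h) \<in> A" "h - z *\<^sub>C f = x" "Im z \<noteq> 0"
  shows "resolvent z x = f"
  unfolding resolvent_def using assms A_shift_unique by (intro the_equality) blast+

lemma resolvent_in_A:
  assumes "Im z \<noteq> 0"
  shows "(resolvent z x, x + z *\<^sub>C resolvent z x) \<in> A"
proof -
  obtain f h where "(f, h) \<in> A" "h - z *\<^sub>C f = x" using selfadjoint_shift_surj[OF selfadjoint_A assms] .
  moreover from this have "resolvent z x = f" using assms by (intro resolvent_eq)
  ultimately show ?thesis by auto
qed

lemma resolvent_add: "Im z \<noteq> 0 \<Longrightarrow> resolvent z (x + y) = resolvent z x + resolvent z y"
  by (rule resolvent_eq[OF pair_add_subspace[OF A_subspace resolvent_in_A resolvent_in_A]])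
    (simp_all add: scaleC_add_right)

lemma resolvent_scaleC: "Im z \<noteq> 0 \<Longrightarrow> resolvent z (c *\<^sub>C x) = c *\<^sub>C resolvent z x"
  by (rule resolvent_eq[OF pair_scale_subspace[OF A_subspace resolvent_in_A]])
    (simp_all add: scaleC_add_right scaleC_scaleC mult.commute)

lemma resolvent_bound: "\<bar>Im z\<bar> * norm (resolvent z x) \<le> norm x" if "Im z \<noteq> 0"
  using symmetric_shift_bound[OF A_symmetric resolvent_in_A[OF that], of z x] by simp

lemma bounded_linear_resolvent:
  assumes "Im z \<noteq> 0" shows "bounded_linear (resolvent z)"
proof (rule bounded_linear_intro[where K = "1 / \<bar>Im z\<bar>"])
  show "norm (resolvent z x) \<le> norm x * (1 / \<bar>Im z\<bar>)" for x
    using resolvent_bound[OF assms, of x] assms by (simp add: field_simps)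
qed (simp_all add: scaleR_scaleC resolvent_add[OF assms] resolvent_scaleC[OF assms])

lemma resolvent_cinner:
  assumes "Im z \<noteq> 0"
  shows "cinner (resolvent z x) y = cinner x (resolvent (cnj z) y)"
proof -
  have "cinner (x + z *\<^sub>C resolvent z x) (resolvent (cnj z) y)
      = cinner (resolvent z x) (y + cnj z *\<^sub>C resolvent (cnj z) y)"
    using assms by (intro A_cinner resolvent_in_A) simp_all
  then show ?thesis by (simp add: cinner_expand)
qed

text \<open>The vector \<open>(A - i) (A - z)\<^sup>-\<^sup>1 g\<^sub>+\<close>: a generator of the deficiency space at \<open>z\<close>, normalised so that
  its two boundary coefficients add up to one. With this normalisation the resolvent of \<open>A\<close> acts
  on the family by difference quotients.\<close>

definition gvec :: "complex \<Rightarrow> 'a"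
  where "gvec z = gp + (z - \<i>) *\<^sub>C resolvent z gp"

lemma gvec_minus_gp:
  assumes "Im z \<noteq> 0"
  shows "(gvec z - gp, z *\<^sub>C gvec z - \<i> *\<^sub>C gp) \<in> A"
proof -
  have "z *\<^sub>C gvec z - \<i> *\<^sub>C gp = (z - \<i>) *\<^sub>C (gp + z *\<^sub>C resolvent z gp)"
    by (simp add: gvec_def scaleC_add_right complex_vector.scale_left_diff_distrib
        complex_vector.scale_right_diff_distrib scaleC_scaleC algebra_simps)
  moreover have "gvec z - gp = (z - \<i>) *\<^sub>C resolvent z gp" by (simp add: gvec_def)
  ultimately show ?thesis
    using pair_scale_subspace[OF A_subspace resolvent_in_A[OF assms], of "z - \<i>" gp] by simp
qed

lemma gvec_deficiency:
  assumes "Im z \<noteq> 0" shows "gvec z \<in> deficiency_space A0 z"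
proof -
  have "(gvec z - gp + gp, z *\<^sub>C gvec z - \<i> *\<^sub>C gp + \<i> *\<^sub>C gp) \<in> adjoint_op A0"
    using gvec_minus_gp[OF assms] A_sub_adjoint gp_adjoint
    by (intro pair_add_subspace[OF adjoint_subspace]) auto
  then show ?thesis by (simp add: mem_deficiency_space)
qed

text \<open>The single function of \<open>z\<close> that determines all inner products of the vectors \<open>gvec z\<close>.\<close>

definition weight :: "complex \<Rightarrow> complex"
  where "weight z = bp (gvec z) (z *\<^sub>C gvec z)"

lemma gvec_minus_coeff:
  assumes "Im z \<noteq> 0" shows "bm (gvec z) (z *\<^sub>C gvec z) = 1 - weight z"
proof -
  have "bp (gvec z - gp) (z *\<^sub>C gvec z - \<i> *\<^sub>C gp) + bm (gvec z - gp) (z *\<^sub>C gvec z - \<i> *\<^sub>C gp) = 0"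
    by (rule coeffs_A[OF gvec_minus_gp[OF assms]])
  then have "weight z - 1 + bm (gvec z) (z *\<^sub>C gvec z) = 0"
    by (simp add: plus_coeff_linear minus_coeff_linear weight_def)
  then show ?thesis by (simp add: algebra_simps)
qed

lemma gvec_nonzero:
  assumes "Im z \<noteq> 0" shows "gvec z \<noteq> 0"
proof
  assume "gvec z = 0"
  moreover have "weight z + bm (gvec z) (z *\<^sub>C gvec z) = 1" using gvec_minus_coeff[OF assms] by simp
  ultimately show False by (simp add: weight_def plus_coeff_def minus_coeff_def)
qed

lemma gvec_i [simp]: "gvec \<i> = gp"
  by (simp add: gvec_def)

lemma gvec_minus_i [simp]: "gvec (- \<i>) = gm"
proof -
  obtain c where c: "gvec (- \<i>) = c *\<^sub>C gm" using minus_space[OF gvec_deficiency[of "- \<i>"]] by auto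
  have "weight (- \<i>) = 0" unfolding weight_def plus_coeff_eigen by simp
  then have "bm (gvec (- \<i>)) ((- \<i>) *\<^sub>C gvec (- \<i>)) = 1" using gvec_minus_coeff[of "- \<i>"] by simp
  moreover have "(- \<i>) *\<^sub>C c *\<^sub>C gm = c *\<^sub>C (- \<i>) *\<^sub>C gm" by (simp add: scaleC_scaleC mult.commute)
  ultimately have "c = 1" unfolding c by (simp only: minus_coeff_linear bm_gm) simp
  then show ?thesis using c by (simp add: scaleC_one)
qed

text \<open>Green's identity for two eigenvectors, whose coefficients are \<open>(p, 1 - p)\<close> and \<open>(q, 1 - q)\<close>:
  the quadratic terms of \<open>p cnj q - (1 - p) cnj (1 - q)\<close> cancel. For \<open>z = cnj w\<close> the left-hand side
  carries no information on the inner product.\<close>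

lemma gvec_cinner:
  assumes "Im z \<noteq> 0" "Im w \<noteq> 0"
  shows "(z - cnj w) * cinner (gvec z) (gvec w) = 2 * \<i> * (weight z + cnj (weight w) - 1)"
proof -
  have "cinner (z *\<^sub>C gvec z) (gvec w) - cinner (gvec z) (w *\<^sub>C gvec w)
      = 2 * \<i> * (weight z * cnj (weight w) - (1 - weight z) * cnj (1 - weight w))"
    unfolding weight_def[symmetric] gvec_minus_coeff[OF assms(1), symmetric]
      gvec_minus_coeff[OF assms(2), symmetric]
    unfolding weight_def
    using gvec_deficiency assms by (intro Green_identity) (simp_all add: mem_deficiency_space)
  then show ?thesis by (simp add: cinner_expand algebra_simps)
qed

lemma resolvent_gvec:
  assumes "Im z \<noteq> 0" "Im w \<noteq> 0" "z \<noteq> w"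
  shows "resolvent z (gvec w) = (1 / (z - w)) *\<^sub>C (gvec z - gvec w)"
proof (rule resolvent_eq[OF pair_scale_subspace[OF A_subspace] _ assms(1)])
  show "(gvec z - gvec w, z *\<^sub>C gvec z - w *\<^sub>C gvec w) \<in> A"
    using pair_diff_subspace[OF A_subspace gvec_minus_gp[OF assms(1)] gvec_minus_gp[OF assms(2)]] by simp
  have "(1 / (z - w)) *\<^sub>C (z *\<^sub>C gvec z - w *\<^sub>C gvec w) - z *\<^sub>C (1 / (z - w)) *\<^sub>C (gvec z - gvec w)
      = (1 / (z - w)) *\<^sub>C (z - w) *\<^sub>C gvec w"
    by (simp add: complex_vector.scale_right_diff_distrib complex_vector.scale_left_diff_distrib
        scaleC_scaleC mult.commute)
  then show "(1 / (z - w)) *\<^sub>C (z *\<^sub>C gvec z - w *\<^sub>C gvec w)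
      - z *\<^sub>C (1 / (z - w)) *\<^sub>C (gvec z - gvec w) = gvec w"
    using assms(3) by (simp add: scaleC_scaleC scaleC_one)
qed

lemma eventually_nonreal: "Im w \<noteq> 0 \<Longrightarrow> eventually (\<lambda>z. Im z \<noteq> 0) (at w)"
  by (intro tendsto_imp_eventually_ne[of Im "Im w"] tendsto_intros)

text \<open>Continuity recovers the inner products \<open>(gvec z, gvec w)\<close> with \<open>z = cnj w\<close>, which Green's identity
  leaves undetermined.\<close>

lemma gvec_tendsto:
  assumes "Im w \<noteq> 0" shows "(gvec \<longlongrightarrow> gvec w) (at w)"
proof (rule LIM_zero_cancel, rule Lim_null_comparison)
  have "eventually (\<lambda>z. Im z \<noteq> 0 \<and> z \<noteq> w) (at w)"
    using eventually_nonreal[OF assms] eventually_neq_at_within by (rule eventually_conj)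
  then show "eventually (\<lambda>z. norm (gvec z - gvec w) \<le> cmod (z - w) / \<bar>Im z\<bar> * norm (gvec w)) (at w)"
  proof (rule eventually_mono, elim conjE)
    fix z assume z: "Im z \<noteq> 0" "z \<noteq> w"
    have "gvec z - gvec w = (z - w) *\<^sub>C resolvent z (gvec w)"
      using z(2) by (simp add: resolvent_gvec[OF z(1) assms z(2)] scaleC_scaleC scaleC_one)
    then have "norm (gvec z - gvec w) = cmod (z - w) * norm (resolvent z (gvec w))"
      by (simp add: norm_scaleC)
    also have "\<dots> \<le> cmod (z - w) * (norm (gvec w) / \<bar>Im z\<bar>)"
      using resolvent_bound[OF z(1), of "gvec w"] z(1)
      by (intro mult_left_mono) (simp_all add: field_simps)
    finally show "norm (gvec z - gvec w) \<le> cmod (z - w) / \<bar>Im z\<bar> * norm (gvec w)" by simp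
  qed
  have "((\<lambda>z. cmod (z - w) / \<bar>Im z\<bar> * norm (gvec w)) \<longlongrightarrow> cmod (w - w) / \<bar>Im w\<bar> * norm (gvec w)) (at w)"
    using assms by (intro tendsto_intros) simp
  then show "((\<lambda>z. cmod (z - w) / \<bar>Im z\<bar> * norm (gvec w)) \<longlongrightarrow> 0) (at w)" by simp
qed

subsection \<open>Density of the eigenvectors\<close>

text \<open>Let \<open>N\<close> be the orthogonal complement of all \<open>gvec z\<close>. It is invariant under \<open>A0\<close>, since the
  \<open>gvec z\<close> are eigenvectors of the adjoint, and under the resolvents of \<open>A\<close>, since these map the family
  to difference quotients of itself. As \<open>g\<^sub>+\<close> belongs to the family, the resolvents even map \<open>N\<close> into
  the domain of \<open>A0\<close>. Hence the restriction of \<open>A0\<close> to \<open>N\<close> is symmetric, and \<open>A0 + i\<close>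
  and \<open>A0 - i\<close> map its domain onto \<open>N\<close>. So it is self-adjoint, and \<open>N\<close> vanishes because \<open>A0\<close>
  is prime.\<close>

lemma gvec_span_dense:
  assumes prime: "prime_op A0"
  shows "closure (complex_vector.span (gvec ` {z. Im z \<noteq> 0})) = UNIV"
proof (rule closure_eq_UNIV_if_orthogonal_trivial[OF complex_vector.subspace_span])
  define N where "N = {x. \<forall>z. Im z \<noteq> 0 \<longrightarrow> cinner x (gvec z) = 0}"
  have N: "cinner x (gvec z) = 0" if "x \<in> N" "Im z \<noteq> 0" for x z
    using that by (simp add: N_def)
  have N_sub: "complex_vector.subspace N"
    by (rule complex_vector.subspaceI) (auto simp: N_def cinner_expand)
  have "N = (\<Inter>z\<in>{z. Im z \<noteq> 0}. {x. cinner x (gvec z) = 0})" by (auto simp: N_def)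
  then have N_closed: "closed N"
    by (auto intro!: closed_INT closed_Collect_eq continuous_on_cinner continuous_intros)
  have N_gp: "cinner x gp = 0" if "x \<in> N" for x using N[OF that, of \<i>] by simp
  have inv: "h \<in> N" if "(f, h) \<in> A0" "f \<in> N" for f h
    unfolding N_def
  proof (intro CollectI allI impI)
    fix z :: complex assume z: "Im z \<noteq> 0"
    have "cinner h (gvec z) = cinner f (z *\<^sub>C gvec z)"
      using adjoint_cinner[OF that(1)] gvec_deficiency[OF z] by (simp add: mem_deficiency_space)
    then show "cinner h (gvec z) = 0" using N[OF that(2) z] by (simp add: cinner_expand)
  qed
  have res_N: "resolvent w x \<in> N" if x: "x \<in> N" and w: "Im w \<noteq> 0" for w x
    unfolding N_def
  proof (intro CollectI allI impI)
    have w': "Im (cnj w) \<noteq> 0" using w by simp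
    have off: "cinner (resolvent w x) (gvec z) = 0" if z: "Im z \<noteq> 0" "z \<noteq> cnj w" for z
    proof -
      have "cinner (resolvent w x) (gvec z) = cinner x (resolvent (cnj w) (gvec z))"
        using w by (rule resolvent_cinner)
      also have "\<dots> = 0" using z(2)
        by (simp add: resolvent_gvec[OF w' z(1)] cinner_expand N[OF x w'] N[OF x z(1)])
      finally show ?thesis .
    qed
    fix z :: complex assume z: "Im z \<noteq> 0"
    \<comment> \<open>At \<open>z = cnj w\<close> the difference quotient is not available, and the value follows by continuity.\<close>
    show "cinner (resolvent w x) (gvec z) = 0"
    proof (cases "z = cnj w")
      case True
      have "eventually (\<lambda>u. Im u \<noteq> 0 \<and> u \<noteq> z) (at z)"
        using eventually_nonreal[OF z] eventually_neq_at_within by (rule eventually_conj)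
      then have "eventually (\<lambda>u. cinner (resolvent w x) (gvec u) = 0) (at z)"
        by (rule eventually_mono) (use off True in auto)
      then have "((\<lambda>u. cinner (resolvent w x) (gvec u)) \<longlongrightarrow> 0) (at z)" by (rule tendsto_eventually)
      with tendsto_cinner[OF tendsto_const gvec_tendsto[OF z]] show ?thesis
        by (rule tendsto_unique[OF at_neq_bot])
    qed (use off z in auto)
  qed
  define T where "T = restrict_op A0 N"
  have T: "(f, h) \<in> T \<longleftrightarrow> (f, h) \<in> A0 \<and> f \<in> N" for f h by (simp add: T_def restrict_op_def)
  have res_T: "(resolvent w x, x + w *\<^sub>C resolvent w x) \<in> T" if x: "x \<in> N" and w: "Im w \<noteq> 0" for w x
    unfolding T
  proof
    show "resolvent w x \<in> N" by (rule res_N[OF that])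
    from N_gp[OF this] show "(resolvent w x, x + w *\<^sub>C resolvent w x) \<in> A0"
      by (intro A0_if_plus_coeff_zero resolvent_in_A[OF w])
        (simp add: plus_coeff_def cinner_expand N_gp[OF x])
  qed
  have T_sub: "complex_vector.subspace T"
  proof (rule complex_vector.subspaceI)
    show "0 \<in> T"
      using complex_vector.subspace_0[OF A0_subspace] complex_vector.subspace_0[OF N_sub] T
      by (simp add: zero_prod_def)
    fix p q assume "p \<in> T" "q \<in> T"
    then show "p + q \<in> T"
      by (cases p; cases q)
        (auto simp: T intro: pair_add_subspace[OF A0_subspace] complex_vector.subspace_add[OF N_sub])
  next
    fix c p assume "p \<in> T"
    then show "c *\<^sub>C p \<in> T"
      by (cases p)
        (auto simp: T scaleC_prod_def
          intro: pair_scale_subspace[OF A0_subspace] complex_vector.subspace_scale[OF N_sub])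
  qed
  have "single_valued A0"
    using symmetric by (simp add: symmetric_op_def linear_operator_def)
  then have T_lin: "linear_operator T"
    using T_sub T unfolding linear_operator_def single_valued_def by blast
  have T_N: "T \<subseteq> N \<times> N" using inv T by auto
  have T_sym: "cinner h g = cinner f k" if "(f, h) \<in> T" "(g, k) \<in> T" for f h g k
    using adjoint_cinner[of f h g k] that A0_sub_adjoint T by blast
  have "N \<subseteq> closure (Domain T)"
  proof
    fix x assume x: "x \<in> N"
    obtain y where y: "y \<in> closure (Domain T)" "\<And>m. m \<in> closure (Domain T) \<Longrightarrow> cinner m (x - y) = 0"
      using orthogonal_projection[OF closure_subspace[OF subspace_Domain[OF T_sub]] closed_closure, of x]
      by blast
    have "closure (Domain T) \<subseteq> N" using T_N N_closed by (intro closure_minimal) auto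
    then have w: "x - y \<in> N" using x y(1) by (intro complex_vector.subspace_diff[OF N_sub]) auto
    define f where "f = resolvent (- \<i>) (x - y)"
    have fT: "(f, (x - y) + (- \<i>) *\<^sub>C f) \<in> T" unfolding f_def by (rule res_T[OF w]) simp
    then have fw: "cinner f (x - y) = 0" by (intro y(2) subsetD[OF closure_subset] DomainI)
    then have wf: "cinner (x - y) f = 0" using cinner_commute[of "x - y" f] by simp
    have "cinner ((x - y) + (- \<i>) *\<^sub>C f) f = cinner f ((x - y) + (- \<i>) *\<^sub>C f)"
      by (rule T_sym[OF fT fT])
    then have "cinner f f = 0"
      unfolding cinner_add_left cinner_add_right fw wf cinner_scaleC_left cinner_scaleC_right
      by (simp add: eq_neg_iff_add_eq_0)
    then have "f = 0" by simp
    then have "(0, x - y) \<in> T" using fT by simp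
    moreover have "(0, 0) \<in> T"
      using complex_vector.subspace_0[OF T_sub] unfolding zero_prod_def .
    moreover have "single_valued T" using T_lin by (simp add: linear_operator_def)
    ultimately have "x - y = 0" by (metis single_valuedD)
    then show "x \<in> closure (Domain T)" using y(1) by simp
  qed
  moreover have "adjoint_in N T = T"
  proof (intro equalityI subrelI)
    fix g k assume "(g, k) \<in> adjoint_in N T"
    then have gN: "g \<in> N" and kN: "k \<in> N" and gk: "\<And>f h. (f, h) \<in> T \<Longrightarrow> cinner h g = cinner f k"
      by (auto simp: adjoint_in_def)
    define x where "x = k - (- \<i>) *\<^sub>C g"
    have xN: "x \<in> N" unfolding x_def
      using gN kN N_sub by (intro complex_vector.subspace_diff complex_vector.subspace_scale)
    define f1 where "f1 = resolvent (- \<i>) x"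
    define h1 where "h1 = x + (- \<i>) *\<^sub>C f1"
    have f1: "(f1, h1) \<in> T" unfolding f1_def h1_def by (rule res_T[OF xN]) simp
    define v where "v = g - f1"
    have vN: "v \<in> N" unfolding v_def using gN f1 T N_sub complex_vector.subspace_diff by blast
    have kh: "k - h1 = (- \<i>) *\<^sub>C v"
      by (simp add: h1_def x_def v_def complex_vector.scale_right_diff_distrib)
    define f where "f = resolvent \<i> v"
    have f: "(f, v + \<i> *\<^sub>C f) \<in> T" unfolding f_def by (rule res_T[OF vN]) simp
    have "cinner (v + \<i> *\<^sub>C f) v = cinner f (k - h1)"
      using gk[OF f] T_sym[OF f f1] by (simp add: v_def cinner_diff_right)
    then have "cinner v v = 0" unfolding kh by (simp add: cinner_expand)
    then have "v = 0" by simp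
    then have "g = f1" "k = h1" using kh by (simp_all add: v_def)
    then show "(g, k) \<in> T" using f1 by simp
  next
    fix g k assume gk: "(g, k) \<in> T"
    then have "g \<in> N" "k \<in> N" using T_N by auto
    then show "(g, k) \<in> adjoint_in N T" using T_sym[OF _ gk] by (auto simp: adjoint_in_def)
  qed
  ultimately have "selfadjoint_in N (restrict_op A0 N)"
    using T_lin T_N by (simp add: selfadjoint_in_def densely_defined_in_def T_def)
  then have N0: "N = {0}"
    using prime N_sub N_closed inv unfolding prime_op_def by blast
  fix x assume x: "\<And>m. m \<in> complex_vector.span (gvec ` {z. Im z \<noteq> 0}) \<Longrightarrow> cinner m x = 0"
  have "cinner x (gvec z) = 0" if "Im z \<noteq> 0" for z
    using x[of "gvec z"] that cinner_commute[of x "gvec z"]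
    by (simp add: complex_vector.span_base)
  then have "x \<in> N" by (simp add: N_def)
  then show "x = 0" using N0 by simp
qed

subsection \<open>The Livsic function\<close>

text \<open>A combination of two eigenvectors whose \<open>g\<^sub>+\<close>-coefficient vanishes is zero. So the deficiency
  space is one-dimensional at every point of the upper half-plane, and the Livsic function does not
  depend on the eigenvector by which it is computed.\<close>

lemma coeffs_proportional:
  assumes "Im z > 0" "v \<in> deficiency_space A0 z" "u \<in> deficiency_space A0 z"
  shows "bm u (z *\<^sub>C u) * bp v (z *\<^sub>C v) = bm v (z *\<^sub>C v) * bp u (z *\<^sub>C u)"
proof -
  define w where "w = bp v (z *\<^sub>C v) *\<^sub>C u - bp u (z *\<^sub>C u) *\<^sub>C v"
  have zw: "z *\<^sub>C w = bp v (z *\<^sub>C v) *\<^sub>C z *\<^sub>C u - bp u (z *\<^sub>C u) *\<^sub>C z *\<^sub>C v"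
    by (simp add: w_def complex_vector.scale_right_diff_distrib scaleC_scaleC mult.commute)
  have "(w, z *\<^sub>C w) \<in> adjoint_op A0" unfolding zw unfolding w_def
    using assms(2,3) unfolding mem_deficiency_space
    by (intro pair_diff_subspace pair_scale_subspace adjoint_subspace)
  then have w: "w \<in> deficiency_space A0 z" unfolding mem_deficiency_space .
  have "bp w (z *\<^sub>C w) = 0" unfolding zw unfolding w_def by (simp only: plus_coeff_linear) simp
  then have "w = 0" using minus_lt_plus[OF w assms(1)] by fastforce
  then have "bm w (z *\<^sub>C w) = 0" by (simp add: minus_coeff_def)
  then show ?thesis unfolding zw unfolding w_def
    by (simp only: minus_coeff_linear) (simp add: mult.commute)
qed

text \<open>Up to sign the Livsic function is the ratio of the boundary coefficients: the factors
  \<open>z + i\<close> and \<open>z - i\<close> in its definition are those in the coefficients of an eigenvector.\<close>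

lemma Livsic_eq:
  assumes z: "Im z > 0" and v: "v \<in> deficiency_space A0 z" "v \<noteq> 0"
  shows "Livsic A0 gp gm z = - bm v (z *\<^sub>C v) / bp v (z *\<^sub>C v)"
proof -
  define g where "g = (SOME g. g \<in> deficiency_space A0 z \<and> g \<noteq> 0)"
  have "g \<in> deficiency_space A0 z \<and> g \<noteq> 0" unfolding g_def by (rule someI[of _ v]) (use v in simp)
  then have g: "g \<in> deficiency_space A0 z" "g \<noteq> 0" by simp_all
  have nz: "bp g (z *\<^sub>C g) \<noteq> 0" "bp v (z *\<^sub>C v) \<noteq> 0"
    using minus_lt_plus[OF g(1) z g(2)] minus_lt_plus[OF v(1) z v(2)] by auto
  have "Livsic A0 gp gm z = (z - \<i>) / (z + \<i>) * (cinner g gm / cinner g gp)"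
    unfolding Livsic_def Let_def g_def ..
  also have "\<dots> = - bm g (z *\<^sub>C g) / bp g (z *\<^sub>C g)"
    by (simp add: plus_coeff_eigen minus_coeff_eigen)
  also have "\<dots> = - bm v (z *\<^sub>C v) / bp v (z *\<^sub>C v)"
    using coeffs_proportional[OF z g(1) v(1)] nz by (simp add: field_simps)
  finally show ?thesis .
qed

lemma minus_coeff_Livsic:
  assumes z: "Im z > 0" and v: "v \<in> deficiency_space A0 z"
  shows "bm v (z *\<^sub>C v) = - Livsic A0 gp gm z * bp v (z *\<^sub>C v)"
proof (cases "v = 0")
  case False
  then show ?thesis using Livsic_eq[OF z v False] minus_lt_plus[OF v z False] by auto
qed (simp add: plus_coeff_def minus_coeff_def)

lemma Livsic_lt_1:
  assumes z: "Im z > 0" shows "cmod (Livsic A0 gp gm z) < 1"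
proof -
  have g: "gvec z \<in> deficiency_space A0 z" "gvec z \<noteq> 0"
    using z by (simp_all add: gvec_deficiency gvec_nonzero)
  show ?thesis
    using minus_lt_plus[OF g(1) z g(2)] unfolding Livsic_eq[OF z g]
    by (simp add: norm_divide divide_less_eq)
qed

lemma weight_upper:
  assumes z: "Im z > 0" shows "weight z = 1 / (1 - Livsic A0 gp gm z)"
proof -
  have "1 - weight z = - Livsic A0 gp gm z * weight z"
    using minus_coeff_Livsic[OF z gvec_deficiency] gvec_minus_coeff z by (simp add: weight_def)
  then have "weight z * (1 - Livsic A0 gp gm z) = 1" by (simp add: algebra_simps)
  moreover have "1 - Livsic A0 gp gm z \<noteq> 0" using Livsic_lt_1[OF z] by auto
  ultimately show ?thesis by (simp add: field_simps)
qed

text \<open>Green's identity for \<open>gvec z\<close> and \<open>gvec (cnj z)\<close>, where the left-hand side vanishes, continues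
  the weight to the lower half-plane.\<close>

lemma weight_lower:
  assumes z: "Im z \<noteq> 0" shows "weight z = 1 - cnj (weight (cnj z))"
proof -
  have "2 * \<i> * (weight z + cnj (weight (cnj z)) - 1) = 0"
    using gvec_cinner[OF z, of "cnj z"] z by simp
  then have "weight z + cnj (weight (cnj z)) - 1 = 0" by (simp only: mult_eq_0_iff) simp
  then show ?thesis by (simp add: algebra_simps)
qed

text \<open>Admissible pairs \<open>(g\<^sub>+, g\<^sub>-)\<close> differ by unimodular factors, and the condition
  \<open>g\<^sub>+ - g\<^sub>- \<in> Dom A\<close> forces the two factors to coincide.\<close>

lemma frame_unique:
  assumes "deficiency_vectors A0 A hp hm"
  obtains c where "cmod c = 1" "hp = c *\<^sub>C gp" "hm = c *\<^sub>C gm"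
proof -
  have h: "hp \<in> deficiency_space A0 \<i>" "hm \<in> deficiency_space A0 (- \<i>)" "norm hp = 1"
      "hp - hm \<in> Domain A"
    using assms by (simp_all add: deficiency_vectors_def)
  obtain c where c: "hp = c *\<^sub>C gp" using plus_space[OF h(1)] by (rule exE)
  obtain d where d: "hm = d *\<^sub>C gm" using minus_space[OF h(2)] by (rule exE)
  obtain k where k: "(hp - hm, k) \<in> A" using h(4) by (rule DomainE)
  have "(hp - hm, c *\<^sub>C \<i> *\<^sub>C gp - d *\<^sub>C (- \<i>) *\<^sub>C gm) \<in> adjoint_op A0"
    unfolding c d
    by (intro pair_diff_subspace pair_scale_subspace adjoint_subspace gp_adjoint gm_adjoint)
  then have "k = c *\<^sub>C \<i> *\<^sub>C gp - d *\<^sub>C (- \<i>) *\<^sub>C gm"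
    using adjoint_unique[OF subsetD[OF A_sub_adjoint k]] by simp
  then have "bp (hp - hm) (c *\<^sub>C \<i> *\<^sub>C gp - d *\<^sub>C (- \<i>) *\<^sub>C gm)
      + bm (hp - hm) (c *\<^sub>C \<i> *\<^sub>C gp - d *\<^sub>C (- \<i>) *\<^sub>C gm) = 0"
    using coeffs_A[OF k] by simp
  then have "c = d" unfolding c d
    by (simp only: plus_coeff_linear minus_coeff_linear bp_gp bm_gp bp_gm bm_gm) simp
  moreover have "norm gp = 1" using frame by (simp add: deficiency_vectors_def)
  then have "cmod c = 1" using h(3) by (simp add: c norm_scaleC)
  ultimately show ?thesis using c d by (intro that[of c]) simp_all
qed

end

section \<open>Dissipative extensions and the Weyl-Titchmarsh function\<close>

locale dissipative_frame = deficiency_frame +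
  fixes Ah :: "'a operator"
  assumes maximal: "maximal_dissipative_extension A0 Ah" and not_selfadjoint: "Ah \<noteq> adjoint_op Ah"
begin

lemma Ah_extends: "A0 \<subseteq> Ah"
  using maximal by (simp add: maximal_dissipative_extension_def)

lemma Ah_subspace: "complex_vector.subspace Ah"
  using maximal by (simp add: maximal_dissipative_extension_def dissipative_def linear_operator_def)

lemma Ah_nonneg: "(f, h) \<in> Ah \<Longrightarrow> 0 \<le> Im (cinner h f)"
  using maximal unfolding maximal_dissipative_extension_def dissipative_def by blast

text \<open>For \<open>f\<close> in the domain of \<open>Ah\<close> and \<open>g\<close> in that of \<open>A0\<close>, dissipativity on \<open>f + t g\<close> bounds from below an
  expression that is real-affine in \<open>t\<close>, because \<open>(A0 g, g)\<close> is real. So its linear part, which is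
  \<open>Im (t c)\<close> for the defect \<open>c\<close> of the adjoint relation, vanishes.\<close>

lemma Ah_sub_adjoint: "Ah \<subseteq> adjoint_op A0"
proof (rule subrelI)
  fix f h assume f: "(f, h) \<in> Ah"
  show "(f, h) \<in> adjoint_op A0" unfolding mem_adjoint
  proof (intro allI impI)
    fix g k assume g: "(g, k) \<in> A0"
    define c where "c = cinner k f - cinner g h"
    have pos: "0 \<le> Im (cinner h f) + Im (t * c)" for t
    proof -
      have "(f + t *\<^sub>C g, h + t *\<^sub>C k) \<in> Ah"
        using f g Ah_extends by (intro pair_add_subspace pair_scale_subspace Ah_subspace) auto
      then have "0 \<le> Im (cinner (h + t *\<^sub>C k) (f + t *\<^sub>C g))" by (rule Ah_nonneg)
      also have "cinner (h + t *\<^sub>C k) (f + t *\<^sub>C g)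
          = cinner h f + cnj t * cinner h g + t * cinner k f + (t * cnj t) * cinner k g"
        by (simp add: cinner_expand algebra_simps)
      also have "Im (\<dots>) = Im (cinner h f) + Im (cnj t * cinner h g) + Im (t * cinner k f)
          + Im ((t * cnj t) * cinner k g)" by simp
      also have "Im ((t * cnj t) * cinner k g) = 0"
      proof -
        have "cinner k g = cnj (cinner k g)"
          using adjoint_cinner[OF g subsetD[OF A0_sub_adjoint g]] cinner_commute[of k g] by simp
        then have "Im (cinner k g) = 0" by (simp add: complex_eq_iff)
        then show ?thesis by (simp add: complex_mult_cnj)
      qed
      also have "Im (cnj t * cinner h g) = - Im (t * cinner g h)"
        using cinner_commute[of h g] by simp
      finally show ?thesis by (simp add: c_def right_diff_distrib)
    qed
    have "c = 0"
    proof (rule ccontr)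
      assume "c \<noteq> 0"
      \<comment> \<open>The value of the affine expression at \<open>t = - i r cnj c\<close> is then \<open>- 1\<close>.\<close>
      define r where "r = (Im (cinner h f) + 1) / (cmod c)\<^sup>2"
      have "(complex_of_real r * - \<i> * cnj c) * c = - \<i> * complex_of_real (r * (cmod c)\<^sup>2)"
        by (simp add: of_real_cmod_square)
      also have "r * (cmod c)\<^sup>2 = Im (cinner h f) + 1" using \<open>c \<noteq> 0\<close> by (simp add: r_def)
      finally have eq: "(complex_of_real r * - \<i> * cnj c) * c
          = - \<i> * complex_of_real (Im (cinner h f) + 1)" .
      have "Im ((complex_of_real r * - \<i> * cnj c) * c) = - (Im (cinner h f) + 1)"
        unfolding eq by simp
      then show False using pos[of "complex_of_real r * - \<i> * cnj c"] by linarith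
    qed
    then show "cinner k f = cinner g h" by (simp add: c_def)
  qed
qed

lemma coeffs_Ah: "(f, h) \<in> Ah \<Longrightarrow> cmod (bm f h) \<le> cmod (bp f h)"
  using Im_form[of f h] Ah_nonneg[of f h] Ah_sub_adjoint power2_le_imp_le[of "cmod (bm f h)" "cmod (bp f h)"]
  by auto

lemma A_dissipative: "dissipative A"
proof -
  have "Im (cinner h f) = 0" if "(f, h) \<in> A" for f h
    using A_cinner[OF that that] cinner_commute[of h f] by (simp add: complex_eq_iff)
  then show ?thesis using A_symmetric by (auto simp: dissipative_def symmetric_op_def)
qed

text \<open>Dissipativity says \<open>\<bar>b\<bar> \<le> \<bar>a\<bar>\<close> for the boundary coefficients \<open>(a, b)\<close> of elements of \<open>Ah\<close>, so \<open>a = 0\<close>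
  implies \<open>b = 0\<close> and at most one ratio \<open>b / a\<close> occurs. Some element has \<open>a \<noteq> 0\<close>: otherwise \<open>Ah = A0\<close>,
  which is not maximal because \<open>A\<close> is a dissipative proper extension.\<close>

lemma parameter_exists:
  "\<exists>\<kappa>. cmod \<kappa> \<le> 1 \<and>
    (\<forall>x x'. (x, x') \<in> Ah \<longleftrightarrow> (x, x') \<in> adjoint_op A0 \<and> bm x x' = - \<kappa> * bp x x')"
proof -
  have "\<exists>x x'. (x, x') \<in> Ah \<and> bp x x' \<noteq> 0"
  proof (rule ccontr)
    assume "\<not> (\<exists>x x'. (x, x') \<in> Ah \<and> bp x x' \<noteq> 0)"
    then have "bp x x' = 0" "bm x x' = 0" if "(x, x') \<in> Ah" for x x'
      using that coeffs_Ah[OF that] by auto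
    then have "Ah \<subseteq> A0" using Ah_sub_adjoint A0_iff by auto
    then have "Ah = A0" using Ah_extends by simp
    moreover have "A = Ah"
      using maximal A_dissipative extends \<open>Ah = A0\<close> unfolding maximal_dissipative_extension_def by blast
    ultimately have "bp (gp - gm) (\<i> *\<^sub>C gp - (- \<i>) *\<^sub>C gm) = 0"
      using frame_difference_in_A bp_A0 by simp
    then show False by (simp only: plus_coeff_linear bp_gp bp_gm) simp
  qed
  then obtain f h where f: "(f, h) \<in> Ah" "bp f h \<noteq> 0" by (elim exE conjE)
  define \<kappa> where "\<kappa> = - bm f h / bp f h"
  have fk: "bm f h = - \<kappa> * bp f h" using f(2) by (simp add: \<kappa>_def)
  show ?thesis
  proof (intro exI conjI allI)
    show "cmod \<kappa> \<le> 1" using coeffs_Ah[OF f(1)] f(2) by (simp add: \<kappa>_def norm_divide divide_le_eq)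
  next
    fix x x'
    show "(x, x') \<in> Ah \<longleftrightarrow> (x, x') \<in> adjoint_op A0 \<and> bm x x' = - \<kappa> * bp x x'"
    proof (intro iffI conjI)
      assume x: "(x, x') \<in> Ah"
      then show "(x, x') \<in> adjoint_op A0" using Ah_sub_adjoint by blast
      have "(bp f h *\<^sub>C x - bp x x' *\<^sub>C f, bp f h *\<^sub>C x' - bp x x' *\<^sub>C h) \<in> Ah"
        using x f by (intro pair_diff_subspace pair_scale_subspace Ah_subspace)
      from coeffs_Ah[OF this] have "bp f h * bm x x' - bp x x' * bm f h = 0"
        by (simp add: plus_coeff_linear minus_coeff_linear)
      then have "bp f h * bm x x' = bp f h * (- \<kappa> * bp x x')" unfolding fk
        by (simp add: eq_neg_iff_add_eq_0 ac_simps)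
      then show "bm x x' = - \<kappa> * bp x x'" using f(2) by (simp only: mult_cancel_left) simp
    next
      assume x: "(x, x') \<in> adjoint_op A0 \<and> bm x x' = - \<kappa> * bp x x'"
      define c where "c = bp x x' / bp f h"
      have cf: "(c *\<^sub>C f, c *\<^sub>C h) \<in> Ah" by (rule pair_scale_subspace[OF Ah_subspace f(1)])
      have "(x - c *\<^sub>C f, x' - c *\<^sub>C h) \<in> adjoint_op A0"
        using x cf Ah_sub_adjoint by (intro pair_diff_subspace adjoint_subspace) auto
      moreover have "bp (x - c *\<^sub>C f) (x' - c *\<^sub>C h) = 0" "bm (x - c *\<^sub>C f) (x' - c *\<^sub>C h) = 0"
        using x f(2) by (simp_all add: plus_coeff_linear minus_coeff_linear fk c_def)
      ultimately have "(x - c *\<^sub>C f, x' - c *\<^sub>C h) \<in> Ah" using A0_iff Ah_extends by blast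
      from pair_add_subspace[OF Ah_subspace this cf] show "(x, x') \<in> Ah" by simp
    qed
  qed
qed

lemma frame_combination_adjoint:
  "(gp - c *\<^sub>C gm, \<i> *\<^sub>C gp - c *\<^sub>C (- \<i>) *\<^sub>C gm) \<in> adjoint_op A0"
  by (intro pair_diff_subspace pair_scale_subspace adjoint_subspace gp_adjoint gm_adjoint)

lemma bp_frame_combination: "bp (gp - c *\<^sub>C gm) (\<i> *\<^sub>C gp - c *\<^sub>C (- \<i>) *\<^sub>C gm) = 1"
  and bm_frame_combination: "bm (gp - c *\<^sub>C gm) (\<i> *\<^sub>C gp - c *\<^sub>C (- \<i>) *\<^sub>C gm) = - c"
  by (simp_all only: plus_coeff_linear minus_coeff_linear bp_gp bm_gp bp_gm bm_gm) simp_all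

lemma adjoint_of_boundary_condition:
  assumes Ah: "\<And>x x'. (x, x') \<in> Ah \<longleftrightarrow> (x, x') \<in> adjoint_op A0 \<and> bm x x' = - \<kappa> * bp x x'"
  shows "(y, y') \<in> adjoint_op Ah \<longleftrightarrow> (y, y') \<in> adjoint_op A0 \<and> bp y y' = - cnj \<kappa> * bm y y'"
proof (intro iffI conjI)
  assume y: "(y, y') \<in> adjoint_op Ah"
  then show y0: "(y, y') \<in> adjoint_op A0" using adjoint_antimono[OF Ah_extends] by blast
  have "(gp - \<kappa> *\<^sub>C gm, \<i> *\<^sub>C gp - \<kappa> *\<^sub>C (- \<i>) *\<^sub>C gm) \<in> Ah"
    unfolding Ah bp_frame_combination bm_frame_combination
    by (simp add: frame_combination_adjoint[of \<kappa>, simplified])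
  then have "2 * \<i> * (1 * cnj (bp y y') - (- \<kappa>) * cnj (bm y y')) = 0"
    using y Green_identity[OF frame_combination_adjoint y0, of \<kappa>]
    unfolding mem_adjoint bp_frame_combination bm_frame_combination by simp
  then have "cnj (bp y y' + cnj \<kappa> * bm y y') = 0" by simp
  then show "bp y y' = - cnj \<kappa> * bm y y'"
    unfolding complex_cnj_zero_iff by (simp add: eq_neg_iff_add_eq_0)
next
  assume y: "(y, y') \<in> adjoint_op A0 \<and> bp y y' = - cnj \<kappa> * bm y y'"
  show "(y, y') \<in> adjoint_op Ah" unfolding mem_adjoint
  proof (intro allI impI)
    fix x x' assume "(x, x') \<in> Ah"
    then have "cinner x' y - cinner x y' = 0"
      using y Green_identity[of x x' y y'] unfolding Ah by (simp add: mult.commute)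
    then show "cinner x' y = cinner x y'" by simp
  qed
qed

abbreviation "kappa \<equiv> von_Neumann_parameter Ah gp gm"

text \<open>For \<open>\<bar>\<kappa>\<bar> = 1\<close> the boundary conditions \<open>b = - \<kappa> a\<close> of \<open>Ah\<close> and \<open>a = - cnj \<kappa> b\<close> of its adjoint
  coincide, which is excluded since \<open>Ah\<close> is not self-adjoint.\<close>

lemma kappa_lt_1: "cmod kappa < 1"
  and Ah_iff: "(x, x') \<in> Ah \<longleftrightarrow> (x, x') \<in> adjoint_op A0 \<and> bm x x' = - kappa * bp x x'"
  and kappa_eqI: "gp - c *\<^sub>C gm \<in> Domain Ah \<Longrightarrow> kappa = c"
proof -
  obtain \<kappa> where le: "cmod \<kappa> \<le> 1"
    and Ah: "\<And>x x'. (x, x') \<in> Ah \<longleftrightarrow> (x, x') \<in> adjoint_op A0 \<and> bm x x' = - \<kappa> * bp x x'"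
    using parameter_exists by auto
  have "cmod \<kappa> \<noteq> 1"
  proof
    assume "cmod \<kappa> = 1"
    then have k: "\<kappa> * cnj \<kappa> = 1" by (simp flip: of_real_cmod_square)
    have "b = - \<kappa> * a \<longleftrightarrow> a = - cnj \<kappa> * b" for a b
    proof
      assume "b = - \<kappa> * a"
      then have "- cnj \<kappa> * b = (\<kappa> * cnj \<kappa>) * a" by simp
      then show "a = - cnj \<kappa> * b" using k by simp
    next
      assume "a = - cnj \<kappa> * b"
      then have "- \<kappa> * a = (\<kappa> * cnj \<kappa>) * b" by simp
      then show "b = - \<kappa> * a" using k by simp
    qed
    then have "p \<in> Ah \<longleftrightarrow> p \<in> adjoint_op Ah" for p
      by (cases p) (simp only: Ah adjoint_of_boundary_condition[OF Ah])
    then show False using not_selfadjoint by blast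
  qed
  then have lt: "cmod \<kappa> < 1" using le by simp
  have dom: "gp - c *\<^sub>C gm \<in> Domain Ah \<longleftrightarrow> c = \<kappa>" for c
  proof
    assume "gp - c *\<^sub>C gm \<in> Domain Ah"
    then obtain k where k: "(gp - c *\<^sub>C gm, k) \<in> Ah" by (rule DomainE)
    then have "k = \<i> *\<^sub>C gp - c *\<^sub>C (- \<i>) *\<^sub>C gm"
      using adjoint_unique[OF _ frame_combination_adjoint] Ah_sub_adjoint by blast
    then have "(gp - c *\<^sub>C gm, \<i> *\<^sub>C gp - c *\<^sub>C (- \<i>) *\<^sub>C gm) \<in> Ah" using k by simp
    then show "c = \<kappa>" unfolding Ah bp_frame_combination bm_frame_combination by simp
  next
    assume "c = \<kappa>"
    then have "(gp - c *\<^sub>C gm, \<i> *\<^sub>C gp - c *\<^sub>C (- \<i>) *\<^sub>C gm) \<in> Ah"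
      unfolding Ah bp_frame_combination bm_frame_combination using frame_combination_adjoint by simp
    then show "gp - c *\<^sub>C gm \<in> Domain Ah" by (rule DomainI)
  qed
  have kappa: "kappa = \<kappa>"
    unfolding von_Neumann_parameter_def using lt by (intro the_equality) (simp_all add: dom)
  show "cmod kappa < 1" using lt kappa by simp
  show "(x, x') \<in> Ah \<longleftrightarrow> (x, x') \<in> adjoint_op A0 \<and> bm x x' = - kappa * bp x x'"
    unfolding kappa by (rule Ah)
  show "gp - c *\<^sub>C gm \<in> Domain Ah \<Longrightarrow> kappa = c" using dom kappa by simp
qed

lemma kappa_domain: "gp - kappa *\<^sub>C gm \<in> Domain Ah"
proof -
  have "(gp - kappa *\<^sub>C gm, \<i> *\<^sub>C gp - kappa *\<^sub>C (- \<i>) *\<^sub>C gm) \<in> Ah"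
    unfolding Ah_iff bp_frame_combination bm_frame_combination using frame_combination_adjoint by simp
  then show ?thesis by (rule DomainI)
qed

lemma Ah_adjoint_iff:
  "(y, y') \<in> adjoint_op Ah \<longleftrightarrow> (y, y') \<in> adjoint_op A0 \<and> bp y y' = - cnj kappa * bm y y'"
  by (rule adjoint_of_boundary_condition[OF Ah_iff])

abbreviation "s \<equiv> Livsic A0 gp gm"

lemma denominator_nonzero:
  assumes "cmod b < cmod a" shows "a + cnj kappa * b \<noteq> 0"
proof
  assume "a + cnj kappa * b = 0"
  then have "cmod a = cmod kappa * cmod b"
    by (metis add_eq_0_iff2 complex_mod_cnj norm_minus_cancel norm_mult)
  also have "\<dots> \<le> cmod b" using kappa_lt_1 by (simp add: mult_left_le_one_le)
  finally show False using assms by simp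
qed

text \<open>Start from the resolvent of \<open>A\<close> and add the multiple of \<open>gvec z\<close> that achieves the boundary
  condition of the adjoint of \<open>Ah\<close>. The coefficient to divide by does not vanish, because
  \<open>\<bar>b\<bar> < \<bar>a\<bar>\<close> for eigenvectors in the upper half-plane and \<open>\<bar>\<kappa>\<bar> < 1\<close>; uniqueness has the same reason.\<close>

lemma adjoint_shift_solution:
  assumes z: "Im z > 0"
  shows "\<exists>!f. (f, gp + z *\<^sub>C f) \<in> adjoint_op Ah"
proof (rule ex_ex1I)
  define r where "r = resolvent z gp"
  define a where "a = bp r (gp + z *\<^sub>C r) + cnj kappa * bm r (gp + z *\<^sub>C r)"
  have g: "gvec z \<in> deficiency_space A0 z" "gvec z \<noteq> 0"
    using z by (simp_all add: gvec_deficiency gvec_nonzero)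
  define b where "b = bp (gvec z) (z *\<^sub>C gvec z) + cnj kappa * bm (gvec z) (z *\<^sub>C gvec z)"
  have b: "b \<noteq> 0" unfolding b_def by (rule denominator_nonzero[OF minus_lt_plus[OF g(1) z g(2)]])
  define t where "t = - a / b"
  define f where "f = r + t *\<^sub>C gvec z"
  have h: "gp + z *\<^sub>C f = (gp + z *\<^sub>C r) + t *\<^sub>C z *\<^sub>C gvec z"
    by (simp add: f_def scaleC_add_right scaleC_scaleC mult.commute)
  have "(r, gp + z *\<^sub>C r) \<in> A" unfolding r_def using z by (intro resolvent_in_A) simp
  then have "(f, gp + z *\<^sub>C f) \<in> adjoint_op A0"
    unfolding h unfolding f_def using A_sub_adjoint g(1)[unfolded mem_deficiency_space]
    by (intro pair_add_subspace pair_scale_subspace adjoint_subspace) auto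
  moreover have "bp f (gp + z *\<^sub>C f) + cnj kappa * bm f (gp + z *\<^sub>C f) = a + t * b"
    unfolding h unfolding f_def a_def b_def
    by (simp only: plus_coeff_linear minus_coeff_linear) (simp add: algebra_simps)
  then have "bp f (gp + z *\<^sub>C f) = - cnj kappa * bm f (gp + z *\<^sub>C f)"
    using b by (simp add: t_def eq_neg_iff_add_eq_0)
  ultimately have "(f, gp + z *\<^sub>C f) \<in> adjoint_op Ah" by (simp add: Ah_adjoint_iff)
  then show "\<exists>f. (f, gp + z *\<^sub>C f) \<in> adjoint_op Ah" by (rule exI)
next
  fix f f' assume "(f, gp + z *\<^sub>C f) \<in> adjoint_op Ah" "(f', gp + z *\<^sub>C f') \<in> adjoint_op Ah"
  then have "(f - f', (gp + z *\<^sub>C f) - (gp + z *\<^sub>C f')) \<in> adjoint_op Ah"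
    by (rule pair_diff_subspace[OF adjoint_subspace])
  then have d: "(f - f', z *\<^sub>C (f - f')) \<in> adjoint_op Ah"
    by (simp add: complex_vector.scale_right_diff_distrib)
  show "f = f'"
  proof (rule ccontr)
    assume "f \<noteq> f'"
    then have "cmod (bm (f - f') (z *\<^sub>C (f - f'))) < cmod (bp (f - f') (z *\<^sub>C (f - f')))"
      using d z by (intro minus_lt_plus) (simp_all add: mem_deficiency_space Ah_adjoint_iff)
    from denominator_nonzero[OF this] show False using d by (simp add: Ah_adjoint_iff)
  qed
qed

lemma Weyl_denominator_nonzero:
  assumes "Im z > 0" shows "1 - cnj kappa * s z \<noteq> 0"
  using denominator_nonzero[of "- s z" 1] Livsic_lt_1[OF assms] by simp

text \<open>Let \<open>f\<close> solve \<open>((Ah)\<^sup>* - z) f = g\<^sub>+\<close>. Then \<open>(z - i) f + g\<^sub>+\<close> is an eigenvector, so the ratio of its boundary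
  coefficients is \<open>- s z\<close>, while those of \<open>f\<close> satisfy the boundary condition of the adjoint. These
  two linear equations determine the \<open>g\<^sub>+\<close>-coefficient of \<open>f\<close>, which in turn is affine in
  \<open>(f, g\<^sub>+)\<close>.\<close>

theorem Weyl_Titchmarsh_Livsic:
  assumes z: "Im z > 0"
  shows "Weyl_Titchmarsh Ah gp z = \<i> * (1 + cnj kappa * s z) / (1 - cnj kappa * s z)"
proof -
  obtain f where f: "(f, gp + z *\<^sub>C f) \<in> adjoint_op Ah"
    and uniq: "\<And>f'. (f', gp + z *\<^sub>C f') \<in> adjoint_op Ah \<Longrightarrow> f' = f"
    using adjoint_shift_solution[OF z] by (elim ex1E) blast
  define y where "y = z *\<^sub>C (gp + z *\<^sub>C f) + f"
  have rel: "(gp, w) \<in> (affine_op 1 (adjoint_op Ah) (- z))\<inverse> O affine_op z (adjoint_op Ah) 1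
      \<longleftrightarrow> w = y" for w
  proof
    assume "(gp, w) \<in> (affine_op 1 (adjoint_op Ah) (- z))\<inverse> O affine_op z (adjoint_op Ah) 1"
    then obtain f' h' h'' where 1: "(f', h') \<in> adjoint_op Ah" "gp = 1 *\<^sub>C h' + (- z) *\<^sub>C f'"
        and 2: "(f', h'') \<in> adjoint_op Ah" "w = z *\<^sub>C h'' + 1 *\<^sub>C f'"
      by (auto simp: affine_op_def)
    have h': "h' = gp + z *\<^sub>C f'" using 1(2) by (simp add: scaleC_one)
    then have f': "f' = f" using 1(1) uniq by simp
    have "h'' = h'" using 1(1) 2(1) Ah_adjoint_iff adjoint_unique by blast
    then show "w = y" using 2(2) by (simp add: h' f' y_def scaleC_one)
  next
    assume "w = y"
    have "(f, gp) \<in> affine_op 1 (adjoint_op Ah) (- z)"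
      unfolding affine_op_def using f
      by (intro CollectI exI[of _ f] exI[of _ "gp + z *\<^sub>C f"]) (simp add: scaleC_one)
    moreover have "(f, y) \<in> affine_op z (adjoint_op Ah) 1"
      unfolding affine_op_def y_def using f
      by (intro CollectI exI[of _ f] exI[of _ "gp + z *\<^sub>C f"]) (simp add: scaleC_one)
    ultimately show "(gp, w) \<in> (affine_op 1 (adjoint_op Ah) (- z))\<inverse> O affine_op z (adjoint_op Ah) 1"
      using \<open>w = y\<close> by blast
  qed
  then have M: "Weyl_Titchmarsh Ah gp z = cinner y gp"
    by (simp add: Weyl_Titchmarsh_def apply_op_def)
  define P where "P = bp f (gp + z *\<^sub>C f)"
  define Q where "Q = bm f (gp + z *\<^sub>C f)"
  have PQ: "P = - cnj kappa * Q" and f0: "(f, gp + z *\<^sub>C f) \<in> adjoint_op A0"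
    using f by (simp_all add: Ah_adjoint_iff P_def Q_def)
  \<comment> \<open>The eigenvector equation holds at \<open>z = i\<close> as well, where \<open>v = gp\<close>.\<close>
  define v where "v = (z - \<i>) *\<^sub>C f + gp"
  have zv: "z *\<^sub>C v = (z - \<i>) *\<^sub>C (gp + z *\<^sub>C f) + \<i> *\<^sub>C gp"
    by (simp add: v_def scaleC_add_right complex_vector.scale_left_diff_distrib
        complex_vector.scale_right_diff_distrib scaleC_scaleC algebra_simps)
  have "(v, z *\<^sub>C v) \<in> adjoint_op A0" unfolding zv unfolding v_def
    by (intro pair_add_subspace pair_scale_subspace adjoint_subspace f0 gp_adjoint)
  then have "bm v (z *\<^sub>C v) = - s z * bp v (z *\<^sub>C v)"
    using z by (intro minus_coeff_Livsic) (simp_all add: mem_deficiency_space)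
  then have ZQ: "(z - \<i>) * Q = - s z * ((z - \<i>) * P + 1)"
    unfolding zv unfolding v_def by (simp add: plus_coeff_linear minus_coeff_linear P_def Q_def)
  have "(z - \<i>) * P = - cnj kappa * ((z - \<i>) * Q)" by (subst PQ) simp
  also have "\<dots> = cnj kappa * s z * ((z - \<i>) * P + 1)" unfolding ZQ by simp
  finally have "(z - \<i>) * P = cnj kappa * s z * ((z - \<i>) * P + 1)" .
  then have X: "(z - \<i>) * P * (1 - cnj kappa * s z) = cnj kappa * s z"
    by (simp add: algebra_simps)
  have y: "cinner y gp = z + (z - \<i>) * ((z + \<i>) * cinner f gp)"
    by (simp add: y_def cinner_expand algebra_simps)
  have zf: "(z + \<i>) * cinner f gp = 2 * \<i> * P - 1"
  proof -
    have "2 * \<i> * P = cinner (gp + z *\<^sub>C f) gp + \<i> * cinner f gp"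
      by (simp add: P_def plus_coeff_def)
    then show ?thesis by (simp add: cinner_expand algebra_simps)
  qed
  have y_P: "cinner y gp = \<i> + 2 * \<i> * ((z - \<i>) * P)"
    unfolding y zf by (simp add: algebra_simps)
  note nz = Weyl_denominator_nonzero[OF z]
  have P: "(z - \<i>) * P = cnj kappa * s z / (1 - cnj kappa * s z)"
    using X nz by (simp add: eq_divide_eq)
  show ?thesis unfolding M y_P P using nz by (simp add: field_simps)
qed

end

section \<open>Unitary maps from Gram matrices\<close>

lemma unitaryD:
  assumes "unitary U"
  shows unitary_add: "U (x + y) = U x + U y" and unitary_diff: "U (x - y) = U x - U y"
    and unitary_scaleC: "U (c *\<^sub>C x) = c *\<^sub>C U x" and unitary_cinner: "cinner (U x) (U y) = cinner x y"
    and unitary_surj: "\<exists>x. y' = U x" and unitary_inj: "U x = U y \<longleftrightarrow> x = y"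
    and unitary_norm: "norm (U x) = norm x"
proof -
  have lin: "Vector_Spaces.linear scaleC scaleC U" and bij: "bij U"
    and inner: "\<And>x y. cinner (U x) (U y) = cinner x y"
    using assms by (simp_all add: unitary_def)
  show "U (x + y) = U x + U y" "U (c *\<^sub>C x) = c *\<^sub>C U x" for x y
    using lin by (simp_all add: Vector_Spaces.linear_iff)
  from this(1)[of "x - y" y] show "U (x - y) = U x - U y" by (simp add: algebra_simps)
  show "cinner (U x) (U y) = cinner x y" by (rule inner)
  show "\<exists>x. y' = U x" using bij by (simp add: bij_def surj_def)
  show "U x = U y \<longleftrightarrow> x = y" using bij by (simp add: bij_def inj_eq)
  have "(norm (U x))\<^sup>2 = (norm x)\<^sup>2" by (simp add: norm_square_cinner inner)
  then show "norm (U x) = norm x" by (simp add: power2_eq_iff_nonneg)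
qed

lemma bounded_linear_unitary:
  assumes "unitary U" shows "bounded_linear U"
proof (rule bounded_linear_intro[where K = 1])
  show "U (r *\<^sub>R x) = r *\<^sub>R U x" for r x
    by (simp add: scaleR_scaleC unitary_scaleC[OF assms])
qed (simp_all add: unitary_add[OF assms] unitary_norm[OF assms])

text \<open>The closure of a graph, written with separate sequences in the two factors so that it
  commutes visibly with passing to the converse relation.\<close>

definition sequential_closure :: "('a::topological_space \<times> 'b::topological_space) set \<Rightarrow> ('a \<times> 'b) set"
  where "sequential_closure S =
    {(p, q). \<exists>a b. (\<forall>n. (a n, b n) \<in> S) \<and> a \<longlonglongrightarrow> p \<and> b \<longlonglongrightarrow> q}"

lemma sequential_closureI:
  "(\<And>n. (a n, b n) \<in> S) \<Longrightarrow> a \<longlonglongrightarrow> p \<Longrightarrow> b \<longlonglongrightarrow> q \<Longrightarrow> (p, q) \<in> sequential_closure S"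
  by (auto simp: sequential_closure_def)

lemma sequential_closure_total:
  fixes S :: "('a::complex_inner \<times> 'b::chilbert_space) set"
  assumes S: "complex_vector.subspace S" and iso: "\<And>p q. (p, q) \<in> S \<Longrightarrow> norm p = norm q"
    and dense: "closure (Domain S) = UNIV"
  shows "\<exists>q. (p, q) \<in> sequential_closure S"
proof -
  have "p \<in> closure (Domain S)" using dense by simp
  then obtain a where a: "\<And>n. a n \<in> Domain S" "a \<longlonglongrightarrow> p" unfolding closure_sequential by auto
  have "\<forall>n. \<exists>q. (a n, q) \<in> S" using a(1) by (simp add: Domain_iff)
  from choice[OF this] obtain b where b: "\<And>n. (a n, b n) \<in> S" by auto
  have ab: "dist (b m) (b n) = dist (a m) (a n)" for m n
    using iso[OF pair_diff_subspace[OF S b b], of m n] by (simp add: dist_norm)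
  have "Cauchy a" using a(2) by (rule LIMSEQ_imp_Cauchy)
  then have "Cauchy b" unfolding Cauchy_def ab .
  then obtain q where q: "b \<longlonglongrightarrow> q" unfolding Cauchy_convergent_iff convergent_def ..
  show ?thesis using sequential_closureI[OF b a(2) q] by (rule exI)
qed

text \<open>The span of the pairs \<open>(x i, y i)\<close> is the graph of an isometry between dense subspaces. By
  completeness its closure is a relation that is total and onto, and since it preserves inner
  products it is the graph of a unitary map.\<close>

lemma exists_unitary_of_Gram:
  fixes x :: "'i \<Rightarrow> 'a::chilbert_space" and y :: "'i \<Rightarrow> 'b::chilbert_space"
  assumes gram: "\<And>i j. i \<in> I \<Longrightarrow> j \<in> I \<Longrightarrow> cinner (x i) (x j) = cinner (y i) (y j)"
    and dense_x: "closure (complex_vector.span (x ` I)) = UNIV"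
    and dense_y: "closure (complex_vector.span (y ` I)) = UNIV"
  shows "\<exists>U. unitary U \<and> (\<forall>i\<in>I. U (x i) = y i)"
proof -
  define S where "S = complex_vector.span ((\<lambda>i. (x i, y i)) ` I)"
  have S: "complex_vector.subspace S" unfolding S_def by (rule complex_vector.subspace_span)
  have gen: "(x i, y i) \<in> S" if "i \<in> I" for i
    unfolding S_def using that by (intro complex_vector.span_base) auto
  have inner_gen: "S \<subseteq> {(p, q). cinner p (x j) = cinner q (y j)}" if "j \<in> I" for j
    unfolding S_def
  proof (rule complex_vector.span_minimal)
    show "complex_vector.subspace {(p, q). cinner p (x j) = cinner q (y j)}"
      by (rule complex_vector.subspaceI) (auto simp: cinner_expand scaleC_prod_def zero_prod_def)
  qed (use gram that in auto)
  have "S \<subseteq> {(p', q'). cinner p p' = cinner q q'}" if "(p, q) \<in> S" for p q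
    unfolding S_def
  proof (rule complex_vector.span_minimal)
    show "complex_vector.subspace {(p', q'). cinner p p' = cinner q q'}"
      by (rule complex_vector.subspaceI) (auto simp: cinner_expand scaleC_prod_def zero_prod_def)
  qed (use inner_gen that in auto)
  then have inner_S: "cinner p p' = cinner q q'" if "(p, q) \<in> S" "(p', q') \<in> S" for p q p' q'
    using that by blast
  have norm_S: "norm p = norm q" if "(p, q) \<in> S" for p q
  proof -
    have "(norm p)\<^sup>2 = (norm q)\<^sup>2" by (simp add: norm_square_cinner inner_S[OF that that])
    then show ?thesis by (simp add: power2_eq_iff_nonneg)
  qed
  have Domain_S: "complex_vector.span (x ` I) \<subseteq> Domain S"
    by (rule complex_vector.span_minimal[OF _ subspace_Domain[OF S]]) (use gen in auto)
  have S': "complex_vector.subspace (S\<inverse>)" by (rule subspace_converse[OF S])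
  have Range_S: "complex_vector.span (y ` I) \<subseteq> Domain (S\<inverse>)"
    by (rule complex_vector.span_minimal[OF _ subspace_Domain[OF S']]) (use gen in auto)
  define G where "G = sequential_closure S"
  have S_G: "(p, q) \<in> G" if "(p, q) \<in> S" for p q
    unfolding G_def by (rule sequential_closureI[OF that tendsto_const tendsto_const])
  have G_inner: "cinner p p' = cinner q q'" if pq: "(p, q) \<in> G" "(p', q') \<in> G" for p q p' q'
  proof -
    obtain a b where a: "\<And>n. (a n, b n) \<in> S" "a \<longlonglongrightarrow> p" "b \<longlonglongrightarrow> q"
      using pq(1) by (auto simp: G_def sequential_closure_def)
    obtain a' b' where a': "\<And>n. (a' n, b' n) \<in> S" "a' \<longlonglongrightarrow> p'" "b' \<longlonglongrightarrow> q'"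
      using pq(2) by (auto simp: G_def sequential_closure_def)
    have "(\<lambda>n. cinner (b n) (b' n)) \<longlonglongrightarrow> cinner p p'"
      using tendsto_cinner[OF a(2) a'(2)] unfolding inner_S[OF a(1) a'(1)] .
    then show ?thesis using tendsto_cinner[OF a(3) a'(3)] by (rule LIMSEQ_unique)
  qed
  have G_add: "(p + p', q + q') \<in> G" if pq: "(p, q) \<in> G" "(p', q') \<in> G" for p q p' q'
  proof -
    obtain a b where a: "\<And>n. (a n, b n) \<in> S" "a \<longlonglongrightarrow> p" "b \<longlonglongrightarrow> q"
      using pq(1) by (auto simp: G_def sequential_closure_def)
    obtain a' b' where a': "\<And>n. (a' n, b' n) \<in> S" "a' \<longlonglongrightarrow> p'" "b' \<longlonglongrightarrow> q'"
      using pq(2) by (auto simp: G_def sequential_closure_def)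
    show ?thesis unfolding G_def
      by (rule sequential_closureI[OF pair_add_subspace[OF S a(1) a'(1)] tendsto_add[OF a(2) a'(2)]
            tendsto_add[OF a(3) a'(3)]])
  qed
  have G_scale: "(c *\<^sub>C p, c *\<^sub>C q) \<in> G" if pq: "(p, q) \<in> G" for p q c
  proof -
    obtain a b where a: "\<And>n. (a n, b n) \<in> S" "a \<longlonglongrightarrow> p" "b \<longlonglongrightarrow> q"
      using pq(1) by (auto simp: G_def sequential_closure_def)
    show ?thesis unfolding G_def
      by (rule sequential_closureI[OF pair_scale_subspace[OF S a(1)]
            bounded_linear.tendsto[OF bounded_linear_scaleC a(2)]
            bounded_linear.tendsto[OF bounded_linear_scaleC a(3)]])
  qed
  have G_total: "\<exists>q. (p, q) \<in> G" for p
    unfolding G_def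
  proof (rule sequential_closure_total[OF S norm_S])
    show "closure (Domain S) = UNIV" using closure_mono[OF Domain_S] dense_x by auto
  qed
  have G_onto: "\<exists>p. (p, q) \<in> G" for q
  proof -
    have "\<exists>p. (q, p) \<in> sequential_closure (S\<inverse>)"
    proof (rule sequential_closure_total[OF S'])
      show "closure (Domain (S\<inverse>)) = UNIV" using closure_mono[OF Range_S] dense_y by auto
    qed (use norm_S in auto)
    then obtain p where "(q, p) \<in> sequential_closure (S\<inverse>)" by (rule exE)
    then have "(p, q) \<in> G" by (auto simp: G_def sequential_closure_def)
    then show ?thesis by (rule exI)
  qed
  have G_right: "q = q'" if "(p, q) \<in> G" "(p, q') \<in> G" for p q q'
  proof (rule cinner_eqI)
    fix w
    obtain u where u: "(u, w) \<in> G" using G_onto[of w] by (rule exE)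
    show "cinner w q = cinner w q'" using G_inner[OF u that(1)] G_inner[OF u that(2)] by simp
  qed
  have G_left: "p = p'" if "(p, q) \<in> G" "(p', q) \<in> G" for p p' q
  proof (rule cinner_eqI)
    fix w
    obtain u where u: "(w, u) \<in> G" using G_total[of w] by (rule exE)
    show "cinner w p = cinner w p'" using G_inner[OF u that(1)] G_inner[OF u that(2)] by simp
  qed
  obtain U where U: "\<And>p. (p, U p) \<in> G" using choice[of "\<lambda>p q. (p, q) \<in> G"] G_total by auto
  have U_eq: "U p = q" if "(p, q) \<in> G" for p q by (rule G_right[OF U that])
  have "Vector_Spaces.linear scaleC scaleC U"
    unfolding Vector_Spaces.linear_iff
    using U_eq[OF G_add[OF U U]] U_eq[OF G_scale[OF U]]
    by (auto intro: complex_vector.vector_space_axioms)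
  moreover have "bij U"
    unfolding bij_def
  proof
    show "inj U"
    proof (rule injI)
      fix p p' assume "U p = U p'"
      then have "(p, U p') \<in> G" using U[of p] by simp
      then show "p = p'" using U by (rule G_left)
    qed
    show "surj U" unfolding surj_def
    proof
      fix q
      obtain p where "(p, q) \<in> G" using G_onto[of q] by (rule exE)
      from U_eq[OF this] show "\<exists>p. q = U p" by blast
    qed
  qed
  ultimately have "unitary U" unfolding unitary_def using G_inner[OF U U] by simp
  moreover have "\<forall>i\<in>I. U (x i) = y i" using U_eq[OF S_G[OF gen]] by blast
  ultimately show ?thesis by blast
qed

section \<open>Transport along unitary maps\<close>

lemma map_prod_image_iff:
  assumes "unitary U"
  shows "T' = map_prod U U ` T \<longleftrightarrow> (\<forall>x y. (U x, U y) \<in> T' \<longleftrightarrow> (x, y) \<in> T)"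
proof -
  have mem: "(U x, U y) \<in> map_prod U U ` T \<longleftrightarrow> (x, y) \<in> T" for x y
  proof
    show "(x, y) \<in> T \<Longrightarrow> (U x, U y) \<in> map_prod U U ` T" by (rule image_eqI[of _ _ "(x, y)"]) simp_all
  qed (auto simp: unitary_inj[OF assms])
  have all: "p \<in> T' \<longleftrightarrow> p \<in> map_prod U U ` T" if "\<forall>x y. (U x, U y) \<in> T' \<longleftrightarrow> (x, y) \<in> T" for p
  proof -
    obtain x y where "fst p = U x" "snd p = U y"
      using unitary_surj[OF assms, of "fst p"] unitary_surj[OF assms, of "snd p"] by (elim exE)
    then have "p = (U x, U y)" by (simp add: prod_eq_iff)
    then show ?thesis using that mem by simp
  qed
  show ?thesis
  proof
    show "T' = map_prod U U ` T \<Longrightarrow> \<forall>x y. (U x, U y) \<in> T' \<longleftrightarrow> (x, y) \<in> T"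
      using mem by simp
    show "\<forall>x y. (U x, U y) \<in> T' \<longleftrightarrow> (x, y) \<in> T \<Longrightarrow> T' = map_prod U U ` T"
      by (rule set_eqI) (rule all)
  qed
qed

text \<open>Every vector of the target space is of the form \<open>U f\<close>, so the condition defining the adjoint can
  be tested on images only.\<close>

lemma adjoint_transport:
  assumes "unitary U" "\<And>x y. (U x, U y) \<in> T' \<longleftrightarrow> (x, y) \<in> T"
  shows "(U x, U y) \<in> adjoint_op T' \<longleftrightarrow> (x, y) \<in> adjoint_op T"
proof -
  have "(U x, U y) \<in> adjoint_op T'
      \<longleftrightarrow> (\<forall>f f'. (U f, U f') \<in> T' \<longrightarrow> cinner (U f') (U x) = cinner (U f) (U y))"
    unfolding mem_adjoint using unitary_surj[OF assms(1)] by metis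
  also have "\<dots> \<longleftrightarrow> (x, y) \<in> adjoint_op T"
    by (simp add: mem_adjoint assms unitary_cinner[OF assms(1)])
  finally show ?thesis .
qed

lemma deficiency_transport:
  assumes "unitary U" "\<And>x y. (U x, U y) \<in> T' \<longleftrightarrow> (x, y) \<in> T"
  shows "U x \<in> deficiency_space T' z \<longleftrightarrow> x \<in> deficiency_space T z"
  using adjoint_transport[OF assms, of x "z *\<^sub>C x"]
  by (simp add: mem_deficiency_space unitary_scaleC[OF assms(1)])

lemma coeff_transport:
  assumes "unitary U"
  shows "plus_coeff (U g) (U x) (U y) = plus_coeff g x y"
    and "minus_coeff (U g) (U x) (U y) = minus_coeff g x y"
  by (simp_all add: plus_coeff_def minus_coeff_def unitary_cinner[OF assms])

section \<open>Unitary invariants of triples\<close>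

lemma Livsic_phase:
  assumes "cmod c = 1"
  shows "Livsic T (c *\<^sub>C gp) (c *\<^sub>C gm) z = Livsic T gp gm z"
proof -
  have "cnj c \<noteq> 0" using assms by auto
  then show ?thesis by (simp add: Livsic_def Let_def cinner_scaleC_right)
qed

lemma dissipative_frame_of_triple:
  assumes "operator_triple T0 Th T" "deficiency_vectors T0 T gp gm"
  shows "dissipative_frame T0 T gp gm Th"
  using assms unfolding operator_triple_def by unfold_locales auto

text \<open>The images \<open>U g\<^sub>+\<close>, \<open>U g\<^sub>-\<close> form an admissible pair of the second triple with the same invariants,
  and admissible pairs of one triple differ by a common phase, which cancels.\<close>

lemma invariants_of_unitary_equivalence:
  fixes A0 Ah A :: "'a::chilbert_space operator" and B0 Bh B :: "'b::chilbert_space operator"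
  assumes A: "operator_triple A0 Ah A" "deficiency_vectors A0 A gp gm"
    and B: "operator_triple B0 Bh B" "deficiency_vectors B0 B hp hm"
    and equiv: "unitarily_equivalent_triples A0 Ah A B0 Bh B"
  shows "von_Neumann_parameter Bh hp hm = von_Neumann_parameter Ah gp gm"
    and "Im z > 0 \<Longrightarrow> Livsic B0 hp hm z = Livsic A0 gp gm z"
proof -
  obtain U where U: "unitary U" and img: "B0 = map_prod U U ` A0" "Bh = map_prod U U ` Ah"
      "B = map_prod U U ` A"
    using equiv unfolding unitarily_equivalent_triples_def by blast
  have B0: "\<And>x y. (U x, U y) \<in> B0 \<longleftrightarrow> (x, y) \<in> A0"
    and Bh: "\<And>x y. (U x, U y) \<in> Bh \<longleftrightarrow> (x, y) \<in> Ah"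
    and B': "\<And>x y. (U x, U y) \<in> B \<longleftrightarrow> (x, y) \<in> A"
    using img unfolding map_prod_image_iff[OF U] by simp_all
  interpret A: dissipative_frame A0 A gp gm Ah by (rule dissipative_frame_of_triple[OF A])
  interpret B: dissipative_frame B0 B hp hm Bh by (rule dissipative_frame_of_triple[OF B])
  have dv: "deficiency_vectors B0 B (U gp) (U gm)"
    unfolding deficiency_vectors_def deficiency_transport[OF U B0] unitary_norm[OF U]
  proof (intro conjI)
    obtain k where "(gp - gm, k) \<in> A" using A(2) by (auto simp: deficiency_vectors_def)
    then have "(U (gp - gm), U k) \<in> B" using B' by simp
    then show "U gp - U gm \<in> Domain B" by (auto simp: unitary_diff[OF U])
  qed (use A(2) in \<open>simp_all add: deficiency_vectors_def\<close>)
  interpret C: dissipative_frame B0 B "U gp" "U gm" Bh by (rule dissipative_frame_of_triple[OF B(1) dv])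
  obtain c where c: "cmod c = 1" "U gp = c *\<^sub>C hp" "U gm = c *\<^sub>C hm"
    using B.frame_unique[OF dv] by blast
  obtain k where "(gp - A.kappa *\<^sub>C gm, k) \<in> Ah" using A.kappa_domain by (rule DomainE)
  then have "(U (gp - A.kappa *\<^sub>C gm), U k) \<in> Bh" using Bh by simp
  then have "((1 / c) *\<^sub>C U (gp - A.kappa *\<^sub>C gm), (1 / c) *\<^sub>C U k) \<in> Bh"
    by (rule pair_scale_subspace[OF B.Ah_subspace])
  moreover have "(1 / c) *\<^sub>C U (gp - A.kappa *\<^sub>C gm) = hp - A.kappa *\<^sub>C hm"
  proof -
    have "c \<noteq> 0" using c(1) by auto
    then show ?thesis
      by (simp add: unitary_diff[OF U] unitary_scaleC[OF U] c(2,3) scaleC_scaleC scaleC_one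
          complex_vector.scale_right_diff_distrib)
  qed
  ultimately have "hp - A.kappa *\<^sub>C hm \<in> Domain Bh" by auto
  then show "B.kappa = A.kappa" by (rule B.kappa_eqI)
  assume z: "Im z > 0"
  have v: "A.gvec z \<in> deficiency_space A0 z" "A.gvec z \<noteq> 0"
    using z by (simp_all add: A.gvec_deficiency A.gvec_nonzero)
  have "U (A.gvec z) \<in> deficiency_space B0 z" using v(1) by (simp add: deficiency_transport[OF U B0])
  moreover have "U (A.gvec z) \<noteq> 0" using v(2) unitary_norm[OF U, of "A.gvec z"] by auto
  ultimately have "Livsic B0 (U gp) (U gm) z = Livsic A0 gp gm z"
    unfolding A.Livsic_eq[OF z v]
    by (simp add: C.Livsic_eq[OF z] unitary_scaleC[OF U, symmetric] coeff_transport[OF U])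
  then show "Livsic B0 hp hm z = Livsic A0 gp gm z"
    unfolding c(2,3) Livsic_phase[OF c(1)] .
qed

text \<open>The Livsic function determines the weights, hence the Gram matrix of the vectors \<open>gvec z\<close>, so
  a unitary \<open>U\<close> maps the first family to the second. It intertwines the resolvents of \<open>A\<close> and \<open>B\<close>, because
  these act on the families by difference quotients, and therefore maps \<open>A\<close> to \<open>B\<close>. Since \<open>g\<^sub>+\<close> and
  \<open>g\<^sub>-\<close> are members of the family, \<open>U\<close> preserves boundary coefficients and hence maps \<open>A0\<close> and \<open>Ah\<close>,
  which are cut out by boundary conditions, to \<open>B0\<close> and \<open>Bh\<close>.\<close>

lemma unitary_equivalence_of_invariants:
  fixes A0 Ah A :: "'a::chilbert_space operator" and B0 Bh B :: "'b::chilbert_space operator"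
  assumes A: "operator_triple A0 Ah A" "deficiency_vectors A0 A gp gm"
    and B: "operator_triple B0 Bh B" "deficiency_vectors B0 B hp hm"
    and kappa: "von_Neumann_parameter Bh hp hm = von_Neumann_parameter Ah gp gm"
    and livsic: "\<And>z. Im z > 0 \<Longrightarrow> Livsic B0 hp hm z = Livsic A0 gp gm z"
  shows "unitarily_equivalent_triples A0 Ah A B0 Bh B"
proof -
  interpret A: dissipative_frame A0 A gp gm Ah by (rule dissipative_frame_of_triple[OF A])
  interpret B: dissipative_frame B0 B hp hm Bh by (rule dissipative_frame_of_triple[OF B])
  have weight_upper: "B.weight z = A.weight z" if "Im z > 0" for z
    using that by (simp add: A.weight_upper B.weight_upper livsic)
  have weight: "B.weight z = A.weight z" if "Im z \<noteq> 0" for z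
  proof (cases "Im z > 0")
    case False
    then have "Im (cnj z) > 0" using that by simp
    from weight_upper[OF this] show ?thesis
      unfolding A.weight_lower[OF that] B.weight_lower[OF that] by simp
  qed (rule weight_upper)
  let ?I = "{z. Im z \<noteq> 0}"
  have off: "cinner (A.gvec z) (A.gvec w) = cinner (B.gvec z) (B.gvec w)"
    if "Im z \<noteq> 0" "Im w \<noteq> 0" "z \<noteq> cnj w" for z w
  proof -
    have "(z - cnj w) * cinner (A.gvec z) (A.gvec w) = (z - cnj w) * cinner (B.gvec z) (B.gvec w)"
      using that by (simp add: A.gvec_cinner B.gvec_cinner weight)
    then show ?thesis using that(3) by simp
  qed
  have gram: "cinner (A.gvec z) (A.gvec w) = cinner (B.gvec z) (B.gvec w)"
    if z: "Im z \<noteq> 0" and w: "Im w \<noteq> 0" for z w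
  proof (cases "z = cnj w")
    case True
    have "eventually (\<lambda>u. Im u \<noteq> 0 \<and> u \<noteq> z) (at z)"
      using A.eventually_nonreal[OF z] eventually_neq_at_within by (rule eventually_conj)
    then have "eventually (\<lambda>u. cinner (A.gvec u) (A.gvec w) = cinner (B.gvec u) (B.gvec w)) (at z)"
      by (rule eventually_mono) (use off w True in auto)
    then have "((\<lambda>u. cinner (B.gvec u) (B.gvec w)) \<longlongrightarrow> cinner (A.gvec z) (A.gvec w)) (at z)"
      using tendsto_cinner[OF A.gvec_tendsto[OF z] tendsto_const] by (rule Lim_transform_eventually[rotated])
    then show ?thesis
      using tendsto_cinner[OF B.gvec_tendsto[OF z] tendsto_const] by (rule tendsto_unique[OF at_neq_bot])
  qed (rule off[OF z w])
  have prime: "prime_op A0" "prime_op B0" using A(1) B(1) by (simp_all add: operator_triple_def)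
  have "\<exists>U. unitary U \<and> (\<forall>z\<in>?I. U (A.gvec z) = B.gvec z)"
    using gram A.gvec_span_dense[OF prime(1)] B.gvec_span_dense[OF prime(2)]
    by (intro exists_unitary_of_Gram) auto
  then obtain U where U: "unitary U" and Ug: "\<And>z. Im z \<noteq> 0 \<Longrightarrow> U (A.gvec z) = B.gvec z" by auto
  have gp: "U gp = hp" using Ug[of \<i>] by simp
  have gm: "U gm = hm" using Ug[of "- \<i>"] by simp
  have mi: "Im (- \<i>) \<noteq> 0" by simp
  define X where "X = {x. U (A.resolvent (- \<i>) x) = B.resolvent (- \<i>) (U x)}"
  have X_sub: "complex_vector.subspace X"
  proof (rule complex_vector.subspaceI)
    have "U (A.resolvent (- \<i>) (0 *\<^sub>C 0)) = B.resolvent (- \<i>) (U (0 *\<^sub>C 0))"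
      unfolding A.resolvent_scaleC[OF mi] unitary_scaleC[OF U] B.resolvent_scaleC[OF mi] by simp
    then show "0 \<in> X" by (simp add: X_def)
  qed (simp_all add: X_def A.resolvent_add[OF mi] B.resolvent_add[OF mi] unitary_add[OF U]
      A.resolvent_scaleC[OF mi] B.resolvent_scaleC[OF mi] unitary_scaleC[OF U])
  have X_gvec: "A.gvec z \<in> X" if z: "Im z \<noteq> 0" "z \<noteq> - \<i>" for z
    unfolding X_def using z
    by (simp add: A.resolvent_gvec[OF mi z(1)] B.resolvent_gvec[OF mi z(1)] Ug gm unitary_scaleC[OF U]
        unitary_diff[OF U] not_sym[OF z(2)])
  have X_closed: "closed X"
    unfolding X_def
  proof (rule closed_Collect_eq)
    show "continuous_on UNIV (\<lambda>x. U (A.resolvent (- \<i>) x))"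
      by (intro linear_continuous_on bounded_linear_compose[OF bounded_linear_unitary[OF U]]
          A.bounded_linear_resolvent[OF mi])
    show "continuous_on UNIV (\<lambda>x. B.resolvent (- \<i>) (U x))"
      by (intro linear_continuous_on bounded_linear_compose[OF B.bounded_linear_resolvent[OF mi]]
          bounded_linear_unitary[OF U])
  qed
  have X_gm: "A.gvec (- \<i>) \<in> X"
  proof (rule Lim_in_closed_set[OF X_closed _ at_neq_bot A.gvec_tendsto[OF mi]])
    show "eventually (\<lambda>z. A.gvec z \<in> X) (at (- \<i>))"
      using eventually_conj[OF A.eventually_nonreal[OF mi] eventually_neq_at_within]
      by (rule eventually_mono) (use X_gvec in auto)
  qed
  have "A.gvec ` ?I \<subseteq> X" using X_gvec X_gm by blast
  then have "closure (complex_vector.span (A.gvec ` ?I)) \<subseteq> X"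
    using X_sub X_closed by (intro closure_minimal complex_vector.span_minimal)
  then have "X = UNIV" using A.gvec_span_dense[OF prime(1)] by auto
  then have comm: "U (A.resolvent (- \<i>) x) = B.resolvent (- \<i>) (U x)" for x
    by (auto simp: X_def)
  have iff_A: "(U f, U h) \<in> B \<longleftrightarrow> (f, h) \<in> A" for f h
  proof -
    define x where "x = h - (- \<i>) *\<^sub>C f"
    have h: "h = x + (- \<i>) *\<^sub>C f" by (simp add: x_def)
    have "(f, h) \<in> A \<longleftrightarrow> A.resolvent (- \<i>) x = f"
    proof
      show "(f, h) \<in> A \<Longrightarrow> A.resolvent (- \<i>) x = f"
        by (rule A.resolvent_eq[OF _ x_def[symmetric] mi])
      show "A.resolvent (- \<i>) x = f \<Longrightarrow> (f, h) \<in> A"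
        using A.resolvent_in_A[OF mi, of x] unfolding h by simp
    qed
    also have "\<dots> \<longleftrightarrow> B.resolvent (- \<i>) (U x) = U f"
      unfolding comm[symmetric] unitary_inj[OF U] ..
    also have "\<dots> \<longleftrightarrow> (U f, U h) \<in> B"
    proof -
      have Uh: "U h = U x + (- \<i>) *\<^sub>C U f" unfolding h unitary_add[OF U] unitary_scaleC[OF U] ..
      then have Ux: "U h - (- \<i>) *\<^sub>C U f = U x" by simp
      show ?thesis
      proof
        show "(U f, U h) \<in> B \<Longrightarrow> B.resolvent (- \<i>) (U x) = U f"
          by (rule B.resolvent_eq[OF _ Ux mi])
        show "B.resolvent (- \<i>) (U x) = U f \<Longrightarrow> (U f, U h) \<in> B"
          using B.resolvent_in_A[OF mi, of "U x"] unfolding Uh by simp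
      qed
    qed
    finally show ?thesis by simp
  qed
  have bp: "B.bp (U x) (U y) = A.bp x y" and bm: "B.bm (U x) (U y) = A.bm x y" for x y
    unfolding gp[symmetric] gm[symmetric] by (rule coeff_transport[OF U])+
  have iff_A0: "(U f, U h) \<in> B0 \<longleftrightarrow> (f, h) \<in> A0" for f h
  proof -
    have "(f, h) \<in> A0 \<longleftrightarrow> (f, h) \<in> A \<and> A.bp f h = 0"
      using A.extends A.bp_A0 A.A0_if_plus_coeff_zero by auto
    moreover have "(U f, U h) \<in> B0 \<longleftrightarrow> (U f, U h) \<in> B \<and> B.bp (U f) (U h) = 0"
      using B.extends B.bp_A0 B.A0_if_plus_coeff_zero by auto
    ultimately show ?thesis by (simp add: iff_A bp)
  qed
  have iff_Ah: "(U f, U h) \<in> Bh \<longleftrightarrow> (f, h) \<in> Ah" for f h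
    by (simp add: A.Ah_iff B.Ah_iff adjoint_transport[OF U iff_A0] bp bm kappa)
  show ?thesis
    unfolding unitarily_equivalent_triples_def map_prod_image_iff[OF U]
    by (rule exI[of _ U]) (simp add: U map_prod_image_iff[OF U] iff_A0 iff_Ah iff_A)
qed

theorem mainTheorem3:
  fixes A0 Ah A :: "'a::chilbert_space operator" and gpA gmA :: 'a
    and B0 Bh B :: "'b::chilbert_space operator" and gpB gmB :: 'b
    and \<kappa>A \<kappa>B :: complex and MA MB SA SB :: "complex \<Rightarrow> complex"
  assumes "operator_triple A0 Ah A" and "deficiency_vectors A0 A gpA gmA"
    and "operator_triple B0 Bh B" and "deficiency_vectors B0 B gpB gmB"
    and "\<kappa>A = von_Neumann_parameter Ah gpA gmA" and "\<kappa>B = von_Neumann_parameter Bh gpB gmB"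
    and "MA = Weyl_Titchmarsh Ah gpA" and "MB = Weyl_Titchmarsh Bh gpB"
    and "SA = characteristic_function A0 Ah gpA gmA"
    and "SB = characteristic_function B0 Bh gpB gmB"
    and "\<kappa>A \<noteq> 0" and "\<kappa>B \<noteq> 0"
  shows "(\<kappa>A = \<kappa>B \<and> (\<forall>z. Im z > 0 \<longrightarrow> MA z = MB z) \<longrightarrow> (\<forall>z. Im z > 0 \<longrightarrow> SA z = SB z)) \<and>
    (unitarily_equivalent_triples A0 Ah A B0 Bh B \<longleftrightarrow>
      \<kappa>A = \<kappa>B \<and> (\<forall>z. Im z > 0 \<longrightarrow> MA z = MB z))"
proof -
  interpret A: dissipative_frame A0 A gpA gmA Ah
    by (rule dissipative_frame_of_triple[OF assms(1,2)])
  interpret B: dissipative_frame B0 B gpB gmB Bh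
    by (rule dissipative_frame_of_triple[OF assms(3,4)])
  \<comment> \<open>A Moebius transformation is injective, and \<open>\<kappa> \<noteq> 0\<close> can be cancelled from its argument.\<close>
  have M_iff: "MA z = MB z \<longleftrightarrow> Livsic B0 gpB gmB z = Livsic A0 gpA gmA z"
    if k: "\<kappa>A = \<kappa>B" and z: "Im z > 0" for z
  proof -
    define a where "a = cnj A.kappa * A.s z"
    define b where "b = cnj A.kappa * B.s z"
    have kk: "B.kappa = A.kappa" using k assms(5,6) by simp
    have k0: "cnj A.kappa \<noteq> 0" using assms(5,11) by simp
    have nz: "1 - a \<noteq> 0" "1 - b \<noteq> 0"
      using A.Weyl_denominator_nonzero[OF z] B.Weyl_denominator_nonzero[OF z]
      by (simp_all add: a_def b_def kk)
    have "MA z = MB z \<longleftrightarrow> \<i> * (1 + a) / (1 - a) = \<i> * (1 + b) / (1 - b)"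
      unfolding assms(7,8) A.Weyl_Titchmarsh_Livsic[OF z] B.Weyl_Titchmarsh_Livsic[OF z] kk a_def b_def ..
    also have "\<dots> \<longleftrightarrow> (1 + a) * (1 - b) = (1 + b) * (1 - a)"
      using nz by (simp add: frac_eq_eq)
    also have "\<dots> \<longleftrightarrow> 2 * (b - a) = 0" by (auto simp: algebra_simps)
    also have "\<dots> \<longleftrightarrow> b = a" by simp
    also have "\<dots> \<longleftrightarrow> B.s z = A.s z" using k0 by (simp add: a_def b_def)
    finally show ?thesis .
  qed
  have "SA z = SB z" if k: "\<kappa>A = \<kappa>B" and M: "\<forall>z. Im z > 0 \<longrightarrow> MA z = MB z" and z: "Im z > 0" for z
    using M_iff[OF k z] M z k assms(5,6) unfolding assms(9,10) characteristic_function_def by simp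
  moreover have "\<kappa>A = \<kappa>B \<and> (\<forall>z. Im z > 0 \<longrightarrow> MA z = MB z)"
    if equiv: "unitarily_equivalent_triples A0 Ah A B0 Bh B"
  proof -
    have "\<kappa>A = \<kappa>B"
      using invariants_of_unitary_equivalence(1)[OF assms(1-4) equiv] assms(5,6) by simp
    then show ?thesis
      using M_iff invariants_of_unitary_equivalence(2)[OF assms(1-4) equiv] by simp
  qed
  moreover have "unitarily_equivalent_triples A0 Ah A B0 Bh B"
    if k: "\<kappa>A = \<kappa>B" and M: "\<forall>z. Im z > 0 \<longrightarrow> MA z = MB z"
  proof (rule unitary_equivalence_of_invariants[OF assms(1-4)])
    show "B.kappa = A.kappa" using k assms(5,6) by simp
    show "Livsic B0 gpB gmB z = Livsic A0 gpA gmA z" if "Im z > 0" for z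
      using M_iff[OF k that] M that by simp
  qed
  ultimately show ?thesis by blast
qed

end
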